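(* Let $\varphi : R \to S$ be a homomorphism of commutative rings, where $R$ is Noetherian. Let $L$ be an $R$-module and let $M$ be an $S$-module that is flat as an $R$-module (via $\varphi$). (i) Given any $P \in \mathrm{sK}_S(L \otimes_R M)$, there is some $P' \in (\varphi^* )^{-1}(\varphi^*(P))$ such that $P' \subseteq P$ and $P' \in \bigcup_{\mathfrak{p} \in \mathrm{Ass}_R(L)} \mathrm{sK}_S(M/\mathfrak{p} M)$. (ii) The sets $\mathrm{sK}_S(L \otimes_R M)$ and $\bigcup_{\mathfrak{p} \in \mathrm{Ass}_R(L)} \mathrm{sK}_S(M/\mathfrak{p} M)$ have the same minimal elements (with respect to inclusion). (iii) If $\varphi$ further satisfies "INC" (that is, for any prime $\mathfrak{p} \in \mathrm{Spec}\, R$, the elements of the set $(\varphi^* )^{-1}(\{\mathfrak{p}\})$ are pairwise incomparable under inclusion), then \[ \mathrm{sK}_S(L \otimes_R M) = \bigcup_{\mathfrak{p} \in \mathrm{Ass}_R(L)} \mathrm{sK}_S(M/\mathfrak{p} M). \]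
   Context: All rings are commutative with unity; $S$ is not necessarily Noetherian. For a ring $A$ and an $A$-module $N$, the set $\mathrm{sK}_A(N)$ of strong Krull primes of $N$ is the set of all $\mathfrak{p} \in \mathrm{Spec}\, A$ such that for every finitely generated ideal $I$ of $A$ with $I \subseteq \mathfrak{p}$ there is an element $z \in N$ with $I \subseteq \mathrm{ann}_A(z) \subseteq \mathfrak{p}$. $\mathrm{Ass}_R(L)$ denotes the set of associated primes of $L$, i.e. primes of the form $\mathrm{ann}_R(z)$ with $z \in L$. For a ring homomorphism $\varphi : R \to S$, $\varphi^* : \mathrm{Spec}\, S \to \mathrm{Spec}\, R$ denotes the induced map $P \mapsto \varphi^{-1}(P)$. The $S$-module structure on $L \otimes_R M$ is via the factor $M$. *)

theory Defs
  imports
    "HOL-Algebra.Free_Abelian_Groups"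
    "HOL-Algebra.Ring_Divisibility"
    "HOL-Algebra.Generated_Groups"
    "HOL-Algebra.Module"
begin

section \<open>Spectra, associated primes and strong Krull primes\<close>

definition Spec :: "('a, 'x) ring_scheme \<Rightarrow> 'a set set"
  where "Spec A = {\<pp>. primeideal \<pp> A}"

definition spec_map :: "('r, 'x) ring_scheme \<Rightarrow> ('r \<Rightarrow> 's) \<Rightarrow> 's set \<Rightarrow> 'r set"
  where "spec_map R \<phi> P = {r \<in> carrier R. \<phi> r \<in> P}"

definition INC :: "('r, 'x) ring_scheme \<Rightarrow> ('s, 'y) ring_scheme \<Rightarrow> ('r \<Rightarrow> 's) \<Rightarrow> bool"
  where "INC R S \<phi> \<longleftrightarrow>
    (\<forall>\<pp> \<in> Spec R. \<forall>P \<in> Spec S. \<forall>Q \<in> Spec S.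
      spec_map R \<phi> P = \<pp> \<and> spec_map R \<phi> Q = \<pp> \<and> P \<subseteq> Q \<longrightarrow> P = Q)"

definition ann :: "('a, 'x) ring_scheme \<Rightarrow> ('a, 'n, 'z) module_scheme \<Rightarrow> 'n \<Rightarrow> 'a set"
  where "ann A N z = {a \<in> carrier A. a \<odot>\<^bsub>N\<^esub> z = \<zero>\<^bsub>N\<^esub>}"

definition Ass :: "('a, 'x) ring_scheme \<Rightarrow> ('a, 'n, 'z) module_scheme \<Rightarrow> 'a set set"
  where "Ass A N = {\<pp> \<in> Spec A. \<exists>z \<in> carrier N. \<pp> = ann A N z}"

definition fin_gen_ideal :: "'a set \<Rightarrow> ('a, 'x) ring_scheme \<Rightarrow> bool"
  where "fin_gen_ideal I A \<longleftrightarrow> (\<exists>F \<subseteq> carrier A. finite F \<and> I = Idl\<^bsub>A\<^esub> F)"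

definition sK :: "('a, 'x) ring_scheme \<Rightarrow> ('a, 'n, 'z) module_scheme \<Rightarrow> 'a set set"
  where "sK A N = {\<pp> \<in> Spec A. \<forall>I. fin_gen_ideal I A \<and> I \<subseteq> \<pp> \<longrightarrow>
    (\<exists>z \<in> carrier N. I \<subseteq> ann A N z \<and> ann A N z \<subseteq> \<pp>)}"

definition minimal_elements :: "'a set set \<Rightarrow> 'a set set"
  where "minimal_elements X = {P \<in> X. \<forall>Q \<in> X. Q \<subseteq> P \<longrightarrow> Q = P}"


section \<open>Module constructions\<close>

text \<open>
  The record type of modules extends that of rings; its multiplication and unit fields
  are not constrained by the locale \<^locale>\<open>module\<close>, and are left \<^const>\<open>undefined\<close> in the
  modules built below.
\<close>

definition restrict_scalars ::
    "('r \<Rightarrow> 's) \<Rightarrow> ('s, 'm, 'z) module_scheme \<Rightarrow> ('r, 'm) module"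
  where "restrict_scalars \<phi> M =
    \<lparr>carrier = carrier M, monoid.mult = undefined, one = undefined,
     zero = \<zero>\<^bsub>M\<^esub>, add = add M, smult = (\<lambda>r m. \<phi> r \<odot>\<^bsub>M\<^esub> m)\<rparr>"

text \<open>
  \<open>ideal_times \<aa> M\<close> is \<open>\<aa>M\<close>, the additive subgroup of \<open>M\<close> generated by all \<open>a \<odot> m\<close>.
\<close>

definition ideal_times :: "'r set \<Rightarrow> ('r, 'm, 'z) module_scheme \<Rightarrow> 'm set"
  where "ideal_times \<aa> M =
    generate (add_monoid M) {a \<odot>\<^bsub>M\<^esub> m | a m. a \<in> \<aa> \<and> m \<in> carrier M}"

text \<open>
  In \<open>quot_module M N\<close> the scalar multiple of a coset \<open>X\<close> is \<open>N + s X\<close>; adding \<open>N\<close> is needed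
  because \<open>s X\<close> alone can be smaller than a coset.
\<close>

definition quot_module ::
    "('s, 'm, 'z) module_scheme \<Rightarrow> 'm set \<Rightarrow> ('s, 'm set) module"
  where "quot_module M N =
    \<lparr>carrier = a_rcosets\<^bsub>M\<^esub> N, monoid.mult = undefined, one = undefined,
     zero = N, add = set_add M,
     smult = (\<lambda>s X. N <+>\<^bsub>M\<^esub> ((\<lambda>m. s \<odot>\<^bsub>M\<^esub> m) ` X))\<rparr>"

definition module_hom ::
    "('r, 'x) ring_scheme \<Rightarrow> ('r, 'n, 'y) module_scheme \<Rightarrow> ('r, 'k, 'z) module_scheme \<Rightarrow> ('n \<Rightarrow> 'k) set"
  where "module_hom R N K = {f \<in> carrier N \<rightarrow> carrier K.
    (\<forall>x \<in> carrier N. \<forall>y \<in> carrier N. f (x \<oplus>\<^bsub>N\<^esub> y) = f x \<oplus>\<^bsub>K\<^esub> f y) \<and>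
    (\<forall>r \<in> carrier R. \<forall>x \<in> carrier N. f (r \<odot>\<^bsub>N\<^esub> x) = r \<odot>\<^bsub>K\<^esub> f x)}"


section \<open>Tensor products\<close>

text \<open>
  For \<open>R\<close>-modules \<open>L\<close> and \<open>M\<close>, the tensor product is the free abelian group on
  \<open>carrier L \<times> carrier M\<close> modulo the subgroup generated by the bilinearity relations.
\<close>

definition tensor_free ::
    "('r, 'l, 'y) module_scheme \<Rightarrow> ('r, 'm, 'z) module_scheme \<Rightarrow> ('l \<times> 'm \<Rightarrow>\<^sub>0 int) monoid"
  where "tensor_free L M = free_Abelian_group (carrier L \<times> carrier M)"

definition tensor_relators ::
    "('r, 'x) ring_scheme \<Rightarrow> ('r, 'l, 'y) module_scheme \<Rightarrow> ('r, 'm, 'z) module_scheme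
      \<Rightarrow> ('l \<times> 'm \<Rightarrow>\<^sub>0 int) set"
  where "tensor_relators R L M =
    {frag_of (x \<oplus>\<^bsub>L\<^esub> y, m) - frag_of (x, m) - frag_of (y, m) | x y m.
       x \<in> carrier L \<and> y \<in> carrier L \<and> m \<in> carrier M} \<union>
    {frag_of (x, m \<oplus>\<^bsub>M\<^esub> n) - frag_of (x, m) - frag_of (x, n) | x m n.
       x \<in> carrier L \<and> m \<in> carrier M \<and> n \<in> carrier M} \<union>
    {frag_of (r \<odot>\<^bsub>L\<^esub> x, m) - frag_of (x, r \<odot>\<^bsub>M\<^esub> m) | r x m.
       r \<in> carrier R \<and> x \<in> carrier L \<and> m \<in> carrier M}"

definition tensor_null ::
    "('r, 'x) ring_scheme \<Rightarrow> ('r, 'l, 'y) module_scheme \<Rightarrow> ('r, 'm, 'z) module_scheme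
      \<Rightarrow> ('l \<times> 'm \<Rightarrow>\<^sub>0 int) set"
  where "tensor_null R L M = generate (tensor_free L M) (tensor_relators R L M)"

definition tensor_carrier ::
    "('r, 'x) ring_scheme \<Rightarrow> ('r, 'l, 'y) module_scheme \<Rightarrow> ('r, 'm, 'z) module_scheme
      \<Rightarrow> ('l \<times> 'm \<Rightarrow>\<^sub>0 int) set set"
  where "tensor_carrier R L M = rcosets\<^bsub>tensor_free L M\<^esub> (tensor_null R L M)"

text \<open>
  \<open>tensor_map R L' M' f g\<close> is \<open>f \<otimes> g\<close> with target \<open>L' \<otimes>\<^sub>R M'\<close>: the coset of \<open>\<Sum> n\<^sub>i (x\<^sub>i, m\<^sub>i)\<close>
  is sent to the coset of \<open>\<Sum> n\<^sub>i (f x\<^sub>i, g m\<^sub>i)\<close>.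
\<close>

definition tensor_map ::
    "('r, 'x) ring_scheme \<Rightarrow> ('r, 'k, 'y) module_scheme \<Rightarrow> ('r, 'n, 'z) module_scheme
      \<Rightarrow> ('l \<Rightarrow> 'k) \<Rightarrow> ('m \<Rightarrow> 'n) \<Rightarrow> ('l \<times> 'm \<Rightarrow>\<^sub>0 int) set \<Rightarrow> ('k \<times> 'n \<Rightarrow>\<^sub>0 int) set"
  where "tensor_map R L' M' f g X =
    tensor_null R L' M' <#>\<^bsub>tensor_free L' M'\<^esub>
      (frag_extend (\<lambda>(x, m). frag_of (f x, g m)) ` X)"

text \<open>
  The \<open>S\<close>-module \<open>L \<otimes>\<^sub>R M\<close> for an \<open>R\<close>-module \<open>L\<close> and an \<open>S\<close>-module \<open>M\<close>, where \<open>\<phi> : R \<rightarrow> S\<close>.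
\<close>

definition tensor_module ::
    "('r, 'x) ring_scheme \<Rightarrow> ('r \<Rightarrow> 's) \<Rightarrow> ('r, 'l, 'y) module_scheme \<Rightarrow> ('s, 'm, 'z) module_scheme
      \<Rightarrow> ('s, ('l \<times> 'm \<Rightarrow>\<^sub>0 int) set) module"
  where "tensor_module R \<phi> L M = (let M\<^sub>R = restrict_scalars \<phi> M in
    \<lparr>carrier = tensor_carrier R L M\<^sub>R, monoid.mult = undefined, one = undefined,
     zero = tensor_null R L M\<^sub>R, add = set_mult (tensor_free L M\<^sub>R),
     smult = (\<lambda>s. tensor_map R L M\<^sub>R id (\<lambda>m. s \<odot>\<^bsub>M\<^esub> m))\<rparr>)"


section \<open>Flatness\<close>

text \<open>
  \<open>flat_module TYPE('n) R M\<close>: the functor \<open>- \<otimes>\<^sub>R M\<close> preserves injectivity of homomorphisms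
  between \<open>R\<close>-modules. HOL cannot quantify over types inside a formula, so the test modules range over
  those with carrier in the type \<open>'n\<close>. As soon as the element type of \<open>R\<close> embeds into \<open>'n\<close>,
  the inclusions of all ideals into \<open>R\<close> are among the tests (up to isomorphism), and by the
  ideal criterion for flatness the notion is then flatness over \<open>R\<close> in the usual sense,
  independently of \<open>'n\<close>.
\<close>

definition flat_module ::
    "'n itself \<Rightarrow> ('r, 'x) ring_scheme \<Rightarrow> ('r, 'm, 'z) module_scheme \<Rightarrow> bool"
  where "flat_module (_ :: 'n itself) R M \<longleftrightarrow> module R M \<and>
    (\<forall>(N :: ('r, 'n) module) (N' :: ('r, 'n) module) f.
      module R N \<and> module R N' \<and> f \<in> module_hom R N N' \<and> inj_on f (carrier N) \<longrightarrow>
      inj_on (tensor_map R N' M f id) (tensor_carrier R N M))"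

end

theory Submission
  imports Defs
begin

text \<open>
  In fact \<open>sK (L \<otimes>\<^sub>R M)\<close> always equals the union of the sets \<open>sK (M / \<pp>M)\<close>, \<open>\<pp> \<in> Ass L\<close>, from
  which all three claims follow. If \<open>\<pp> = ann y\<close>, then by flatness \<open>y \<otimes> w = 0\<close>
  iff \<open>w \<in> \<pp>M\<close>, so \<open>M / \<pp>M\<close> embeds into \<open>L \<otimes>\<^sub>R M\<close>; this gives one inclusion. Conversely, let
  \<open>P \<in> sK (L \<otimes>\<^sub>R M)\<close> and let \<open>\<qq>\<close> be its preimage in \<open>R\<close>, which is finitely generated. For a finitely
  generated \<open>I \<subseteq> P\<close> choose \<open>z\<close> with \<open>I + \<qq>S \<subseteq> ann z \<subseteq> P\<close>. By flatness \<open>z = \<Sum> x\<^sub>i \<otimes> m\<^sub>i\<close> with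
  \<open>\<qq> x\<^sub>i = 0\<close>. If some \<open>r \<notin> \<qq>\<close> moves the last \<open>x\<^sub>n\<close> into the span of the others, replace \<open>z\<close> by
  \<open>r z\<close>, which shortens the sum. Otherwise \<open>ann x\<^sub>n = \<qq>\<close> and \<open>x\<^sub>n\<close> splits off, so
  \<open>ann z = ann (x\<^sub>n \<otimes> m\<^sub>n) \<inter> ann (z - x\<^sub>n \<otimes> m\<^sub>n)\<close>, and one of the two annihilators lies in the prime
  \<open>P\<close>. Hence eventually \<open>I \<subseteq> ann (y \<otimes> w) \<subseteq> P\<close> for a pure tensor with \<open>ann y = \<qq>\<close>.
\<close>

section \<open>Tensor products on the level of formal sums\<close>

locale tensor = L: module R L + M: module R M
  for R :: "('r, 'x) ring_scheme" and L :: "('r, 'l, 'y) module_scheme"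
    and M :: "('r, 'm, 'z) module_scheme"
begin

lemma tensor_relators_subset: "tensor_relators R L M \<subseteq> carrier (tensor_free L M)"
  by (auto simp: tensor_relators_def tensor_free_def dest!: subsetD[OF keys_diff])

lemma subgroup_tensor_null: "subgroup (tensor_null R L M) (tensor_free L M)"
  unfolding tensor_null_def
  by (rule group.generate_is_subgroup)
    (use tensor_relators_subset in \<open>simp_all add: tensor_free_def\<close>)

lemma tensor_null_subset: "F \<in> tensor_null R L M \<Longrightarrow> Poly_Mapping.keys F \<subseteq> carrier L \<times> carrier M"
  using subgroup.mem_carrier[OF subgroup_tensor_null] by (simp add: tensor_free_def)

lemma tensor_null_zero [simp]: "0 \<in> tensor_null R L M"
  using subgroup.one_closed[OF subgroup_tensor_null] by (simp add: tensor_free_def)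

lemma tensor_null_add:
  "F \<in> tensor_null R L M \<Longrightarrow> G \<in> tensor_null R L M \<Longrightarrow> F + G \<in> tensor_null R L M"
  using subgroup.m_closed[OF subgroup_tensor_null] by (simp add: tensor_free_def)

lemma tensor_null_uminus: "F \<in> tensor_null R L M \<Longrightarrow> - F \<in> tensor_null R L M"
  using subgroup.m_inv_closed[OF subgroup_tensor_null, of F]
  by (simp add: tensor_free_def tensor_null_subset)

lemma tensor_null_diff:
  "F \<in> tensor_null R L M \<Longrightarrow> G \<in> tensor_null R L M \<Longrightarrow> F - G \<in> tensor_null R L M"
  using tensor_null_add[OF _ tensor_null_uminus, of F G] by simp

text \<open>Induction principle for the null subgroup. The constructor \<open>inv\<close> of
  \<open>generate\<close> speaks of the group inverse of a generator, which is turned into unary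
  minus by first placing the generator in the carrier.\<close>

lemma tensor_null_minimal:
  assumes F: "F \<in> tensor_null R L M"
    and rel: "\<And>G. G \<in> tensor_relators R L M \<Longrightarrow> G \<in> H"
    and zero: "0 \<in> H"
    and uminus: "\<And>G. G \<in> H \<Longrightarrow> - G \<in> H"
    and add: "\<And>G G'. G \<in> H \<Longrightarrow> G' \<in> H \<Longrightarrow> G + G' \<in> H"
  shows "F \<in> H"
  using F unfolding tensor_null_def
proof (induction rule: generate.induct)
  case (inv h)
  then have "h \<in> carrier (tensor_free L M)"
    using tensor_relators_subset by blast
  then show ?case
    using inv rel uminus by (simp add: tensor_free_def)
qed (use assms in \<open>auto simp: tensor_free_def\<close>)

text \<open>Bridge from cosets to formal sums: vanishing in the tensor product becomes a membership
  question about one representative.\<close>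

lemma coset_eq_null_iff:
  assumes "Poly_Mapping.keys F \<subseteq> carrier L \<times> carrier M"
  shows "tensor_null R L M #>\<^bsub>tensor_free L M\<^esub> F = tensor_null R L M \<longleftrightarrow> F \<in> tensor_null R L M"
proof -
  have "group (tensor_free L M)" "F \<in> carrier (tensor_free L M)"
    using assms by (simp_all add: tensor_free_def)
  then show ?thesis
    using group.coset_join1 group.coset_join2 subgroup_tensor_null by metis
qed

text \<open>Equality of the represented tensors. Only the difference is tested, so chains of such
  equations need no side conditions on the supports of the intermediate sums.\<close>

definition teq :: "('l \<times> 'm \<Rightarrow>\<^sub>0 int) \<Rightarrow> ('l \<times> 'm \<Rightarrow>\<^sub>0 int) \<Rightarrow> bool" (infix "\<doteq>" 50)
  where "F \<doteq> G \<longleftrightarrow> F - G \<in> tensor_null R L M"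

lemma teq_refl [simp]: "F \<doteq> F"
  by (simp add: teq_def)

lemma teq_sym: "F \<doteq> G \<Longrightarrow> G \<doteq> F"
  unfolding teq_def using tensor_null_uminus by force

lemma teq_trans [trans]: "F \<doteq> G \<Longrightarrow> G \<doteq> H \<Longrightarrow> F \<doteq> H"
  unfolding teq_def using tensor_null_add by force

lemma teq_add: "F \<doteq> F' \<Longrightarrow> G \<doteq> G' \<Longrightarrow> F + G \<doteq> F' + G'"
  unfolding teq_def using tensor_null_add[of "F - F'" "G - G'"] by (simp add: algebra_simps)

lemma teq_uminus: "F \<doteq> F' \<Longrightarrow> - F \<doteq> - F'"
  unfolding teq_def using tensor_null_uminus[of "F - F'"] by (simp add: algebra_simps)

lemma teq_sum: "(\<And>i. i \<in> I \<Longrightarrow> F i \<doteq> G i) \<Longrightarrow> sum F I \<doteq> sum G I"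
  by (induction I rule: infinite_finite_induct) (auto intro: teq_add)

lemma teq_zero_iff: "F \<doteq> 0 \<longleftrightarrow> F \<in> tensor_null R L M"
  by (simp add: teq_def)

lemma teq_null_iff: "F \<doteq> G \<Longrightarrow> F \<in> tensor_null R L M \<longleftrightarrow> G \<in> tensor_null R L M"
  using teq_sym teq_trans teq_zero_iff by blast

lemma teq_add_left:
  assumes "x \<in> carrier L" "y \<in> carrier L" "m \<in> carrier M"
  shows "frag_of (x \<oplus>\<^bsub>L\<^esub> y, m) \<doteq> frag_of (x, m) + frag_of (y, m)"
proof -
  have "frag_of (x \<oplus>\<^bsub>L\<^esub> y, m) - frag_of (x, m) - frag_of (y, m) \<in> tensor_null R L M"
    unfolding tensor_null_def tensor_relators_def using assms by (intro generate.incl) blast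
  then show ?thesis
    by (simp add: teq_def algebra_simps)
qed

lemma teq_add_right:
  assumes "x \<in> carrier L" "m \<in> carrier M" "n \<in> carrier M"
  shows "frag_of (x, m \<oplus>\<^bsub>M\<^esub> n) \<doteq> frag_of (x, m) + frag_of (x, n)"
proof -
  have "frag_of (x, m \<oplus>\<^bsub>M\<^esub> n) - frag_of (x, m) - frag_of (x, n) \<in> tensor_null R L M"
    unfolding tensor_null_def tensor_relators_def using assms by (intro generate.incl) blast
  then show ?thesis
    by (simp add: teq_def algebra_simps)
qed

lemma teq_smult:
  assumes "r \<in> carrier R" "x \<in> carrier L" "m \<in> carrier M"
  shows "frag_of (r \<odot>\<^bsub>L\<^esub> x, m) \<doteq> frag_of (x, r \<odot>\<^bsub>M\<^esub> m)"
  unfolding teq_def tensor_null_def tensor_relators_def using assms by (intro generate.incl) blast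

lemma teq_zero_left:
  assumes "m \<in> carrier M"
  shows "frag_of (\<zero>\<^bsub>L\<^esub>, m) \<doteq> 0"
  using teq_uminus[OF teq_add_left[of "\<zero>\<^bsub>L\<^esub>" "\<zero>\<^bsub>L\<^esub>" m]] assms
    tensor_null_uminus[of "- frag_of (\<zero>\<^bsub>L\<^esub>, m)"]
  by (simp add: teq_def)

lemma teq_zero_right:
  assumes "x \<in> carrier L"
  shows "frag_of (x, \<zero>\<^bsub>M\<^esub>) \<doteq> 0"
  using teq_uminus[OF teq_add_right[of x "\<zero>\<^bsub>M\<^esub>" "\<zero>\<^bsub>M\<^esub>"]] assms
    tensor_null_uminus[of "- frag_of (x, \<zero>\<^bsub>M\<^esub>)"]
  by (simp add: teq_def)

lemma teq_minus_right:
  assumes "x \<in> carrier L" "m \<in> carrier M"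
  shows "frag_of (x, \<ominus>\<^bsub>M\<^esub> m) \<doteq> - frag_of (x, m)"
proof -
  have "0 \<doteq> frag_of (x, \<ominus>\<^bsub>M\<^esub> m) + frag_of (x, m)"
    using teq_trans[OF teq_sym[OF teq_zero_right[of x]], of "frag_of (x, \<ominus>\<^bsub>M\<^esub> m) + frag_of (x, m)"]
      teq_add_right[of x "\<ominus>\<^bsub>M\<^esub> m" m] assms
    by (simp add: M.M.l_neg)
  then show ?thesis
    using teq_sym[of 0] by (simp add: teq_def)
qed

lemma teq_finsum_left:
  assumes "finite I" "x \<in> I \<rightarrow> carrier L" "m \<in> carrier M"
  shows "frag_of (finsum L x I, m) \<doteq> (\<Sum>i\<in>I. frag_of (x i, m))"
  using assms
proof (induction I rule: finite_induct)
  case empty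
  then show ?case
    by (simp add: teq_zero_left)
next
  case (insert k I)
  then have "frag_of (x k \<oplus>\<^bsub>L\<^esub> finsum L x I, m) \<doteq> frag_of (x k, m) + frag_of (finsum L x I, m)"
    by (intro teq_add_left L.M.finsum_closed) auto
  also have "\<dots> \<doteq> frag_of (x k, m) + (\<Sum>i\<in>I. frag_of (x i, m))"
    using insert by (intro teq_add) auto
  finally show ?case
    using insert by (simp add: L.M.finsum_insert Pi_def)
qed

end

section \<open>Functoriality of the tensor product\<close>

abbreviation frag_map2 :: "('l \<Rightarrow> 'k) \<Rightarrow> ('m \<Rightarrow> 'n) \<Rightarrow> ('l \<times> 'm \<Rightarrow>\<^sub>0 int) \<Rightarrow> ('k \<times> 'n \<Rightarrow>\<^sub>0 int)"
  where "frag_map2 f g \<equiv> frag_extend (\<lambda>(x, m). frag_of (f x, g m))"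

text \<open>Well-definedness of f \<otimes> g: linearity of both maps sends each bilinearity relator
  to a relator of the same kind, and \<open>frag_map2\<close> is additive, so the generators
  suffice.\<close>

lemma frag_map2_null:
  assumes "tensor R L M" "tensor R L' M'"
    and f: "f \<in> module_hom R L L'" and g: "g \<in> module_hom R M M'"
    and F: "F \<in> tensor_null R L M"
  shows "frag_map2 f g F \<in> tensor_null R L' M'"
proof -
  interpret T: tensor R L M by fact
  interpret T': tensor R L' M' by fact
  have f': "x \<in> carrier L \<Longrightarrow> f x \<in> carrier L'"
    "\<lbrakk>x \<in> carrier L; y \<in> carrier L\<rbrakk> \<Longrightarrow> f (x \<oplus>\<^bsub>L\<^esub> y) = f x \<oplus>\<^bsub>L'\<^esub> f y"
    "\<lbrakk>r \<in> carrier R; x \<in> carrier L\<rbrakk> \<Longrightarrow> f (r \<odot>\<^bsub>L\<^esub> x) = r \<odot>\<^bsub>L'\<^esub> f x"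
    for x y r
    using f by (auto simp: module_hom_def)
  have g': "m \<in> carrier M \<Longrightarrow> g m \<in> carrier M'"
    "\<lbrakk>m \<in> carrier M; n \<in> carrier M\<rbrakk> \<Longrightarrow> g (m \<oplus>\<^bsub>M\<^esub> n) = g m \<oplus>\<^bsub>M'\<^esub> g n"
    "\<lbrakk>r \<in> carrier R; m \<in> carrier M\<rbrakk> \<Longrightarrow> g (r \<odot>\<^bsub>M\<^esub> m) = r \<odot>\<^bsub>M'\<^esub> g m"
    for m n r
    using g by (auto simp: module_hom_def)
  have "F \<in> {F. frag_map2 f g F \<in> tensor_null R L' M'}"
  proof (rule T.tensor_null_minimal[OF F])
    fix G assume "G \<in> tensor_relators R L M"
    then show "G \<in> {F. frag_map2 f g F \<in> tensor_null R L' M'}"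
      unfolding tensor_relators_def
    proof (elim UnE CollectE exE conjE)
      fix x y m
      assume *: "x \<in> carrier L" "y \<in> carrier L" "m \<in> carrier M"
        and G: "G = frag_of (x \<oplus>\<^bsub>L\<^esub> y, m) - frag_of (x, m) - frag_of (y, m)"
      show ?thesis
        using T'.teq_add_left[of "f x" "f y" "g m"] *
        unfolding G T'.teq_def by (simp add: f' g' frag_extend_diff frag_extend_add diff_diff_eq)
    next
      fix x m n
      assume *: "x \<in> carrier L" "m \<in> carrier M" "n \<in> carrier M"
        and G: "G = frag_of (x, m \<oplus>\<^bsub>M\<^esub> n) - frag_of (x, m) - frag_of (x, n)"
      show ?thesis
        using T'.teq_add_right[of "f x" "g m" "g n"] *
        unfolding G T'.teq_def by (simp add: f' g' frag_extend_diff frag_extend_add diff_diff_eq)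
    next
      fix r x m
      assume *: "r \<in> carrier R" "x \<in> carrier L" "m \<in> carrier M"
        and G: "G = frag_of (r \<odot>\<^bsub>L\<^esub> x, m) - frag_of (x, r \<odot>\<^bsub>M\<^esub> m)"
      show ?thesis
        using T'.teq_smult[of r "f x" "g m"] *
        unfolding G T'.teq_def by (simp add: f' g' frag_extend_diff)
    qed
  qed (auto simp: frag_extend_minus frag_extend_add T'.tensor_null_uminus T'.tensor_null_add)
  then show ?thesis by simp
qed

text \<open>\<open>tensor_map\<close> maps a whole coset elementwise and then adds the target null
  subgroup. The image of the source null subgroup is absorbed there by
  \<open>frag_map2_null\<close>, which leaves a single coset.\<close>

lemma tensor_map_coset:
  assumes "tensor R L M" "tensor R L' M'"
    and f: "f \<in> module_hom R L L'" and g: "g \<in> module_hom R M M'"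
  shows "tensor_map R L' M' f g (tensor_null R L M #>\<^bsub>tensor_free L M\<^esub> F) =
         tensor_null R L' M' #>\<^bsub>tensor_free L' M'\<^esub> frag_map2 f g F"
proof -
  interpret T: tensor R L M by fact
  interpret T': tensor R L' M' by fact
  have "(\<Union>h\<in>tensor_null R L' M'. \<Union>k\<in>frag_map2 f g ` (\<Union>k\<in>tensor_null R L M. {k + F}). {h + k}) =
    (\<Union>h\<in>tensor_null R L' M'. {h + frag_map2 f g F})" (is "?A = ?B")
  proof
    show "?A \<subseteq> ?B"
    proof
      fix G assume "G \<in> ?A"
      then obtain h k where "h \<in> tensor_null R L' M'" "k \<in> tensor_null R L M"
        and G: "G = h + frag_map2 f g (k + F)"
        by blast
      then have "h + frag_map2 f g k \<in> tensor_null R L' M'"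
        using frag_map2_null[OF assms] T'.tensor_null_add by blast
      moreover have "G = (h + frag_map2 f g k) + frag_map2 f g F"
        by (simp only: G frag_extend_add add.assoc)
      ultimately show "G \<in> ?B" by blast
    qed
    show "?B \<subseteq> ?A"
    proof
      fix G assume "G \<in> ?B"
      \<comment> \<open>The element 0 of the source null subgroup exhibits \<open>F\<close> itself
        as a member of its coset.\<close>
      then obtain h where "h \<in> tensor_null R L' M'" "G = h + frag_map2 f g (0 + F)"
        by auto
      then show "G \<in> ?A"
        using T.tensor_null_zero by blast
    qed
  qed
  then show ?thesis
    by (simp only: tensor_map_def r_coset_def set_mult_def tensor_free_def mult_free_Abelian_group)
qed

section \<open>The equational criterion for flatness\<close>

text \<open>Coefficients are total functions whose values outside \<open>I\<close> are ignored. They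
  can thus be added and scaled pointwise, with no bookkeeping about extensionality.\<close>

definition lincomb :: "('r, 'l, 'y) module_scheme \<Rightarrow> ('i \<Rightarrow> 'l) \<Rightarrow> 'i set \<Rightarrow> ('i \<Rightarrow> 'r) \<Rightarrow> 'l"
  where "lincomb L x I c = finsum L (\<lambda>i. c i \<odot>\<^bsub>L\<^esub> x i) I"

context module
begin

context
  fixes I :: "'i set" and x :: "'i \<Rightarrow> 'c"
  assumes fin: "finite I" and x: "x \<in> I \<rightarrow> carrier M"
begin

lemma lincomb_closed: "c \<in> UNIV \<rightarrow> carrier R \<Longrightarrow> lincomb M x I c \<in> carrier M"
  unfolding lincomb_def using x by (auto intro!: M.finsum_closed)

lemma lincomb_add:
  assumes "c \<in> UNIV \<rightarrow> carrier R" "d \<in> UNIV \<rightarrow> carrier R"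
  shows "lincomb M x I (\<lambda>i. c i \<oplus> d i) = lincomb M x I c \<oplus>\<^bsub>M\<^esub> lincomb M x I d"
proof -
  have "lincomb M x I (\<lambda>i. c i \<oplus> d i) = finsum M (\<lambda>i. c i \<odot>\<^bsub>M\<^esub> x i \<oplus>\<^bsub>M\<^esub> d i \<odot>\<^bsub>M\<^esub> x i) I"
    unfolding lincomb_def using assms x
    by (intro M.finsum_cong') (auto simp: smult_l_distr Pi_iff)
  also have "\<dots> = lincomb M x I c \<oplus>\<^bsub>M\<^esub> lincomb M x I d"
    unfolding lincomb_def using assms x by (intro M.finsum_addf) (auto simp: Pi_iff)
  finally show ?thesis .
qed

lemma lincomb_smult:
  assumes "r \<in> carrier R" "c \<in> UNIV \<rightarrow> carrier R"
  shows "lincomb M x I (\<lambda>i. r \<otimes> c i) = r \<odot>\<^bsub>M\<^esub> lincomb M x I c"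
proof -
  have "r \<odot>\<^bsub>M\<^esub> lincomb M x I c = finsum M (\<lambda>i. r \<odot>\<^bsub>M\<^esub> (c i \<odot>\<^bsub>M\<^esub> x i)) I"
    unfolding lincomb_def using fin assms x by (intro finsum_smult_ldistr) (auto simp: Pi_iff)
  also have "\<dots> = lincomb M x I (\<lambda>i. r \<otimes> c i)"
    unfolding lincomb_def using assms x
    by (intro M.finsum_cong') (auto simp: smult_assoc1 Pi_iff)
  finally show ?thesis by simp
qed

lemma lincomb_uminus:
  assumes "c \<in> UNIV \<rightarrow> carrier R"
  shows "lincomb M x I (\<lambda>i. \<ominus> c i) = \<ominus>\<^bsub>M\<^esub> lincomb M x I c"
proof -
  have "(\<lambda>i. \<ominus> c i) = (\<lambda>i. (\<ominus> \<one>) \<otimes> c i)"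
    using assms by (auto simp: R.l_minus Pi_iff)
  then have "lincomb M x I (\<lambda>i. \<ominus> c i) = (\<ominus> \<one>) \<odot>\<^bsub>M\<^esub> lincomb M x I c"
    using lincomb_smult[of "\<ominus> \<one>" c] assms by simp
  then show ?thesis
    using lincomb_closed[OF assms] by (simp add: smult_l_minus)
qed

lemma lincomb_minus:
  assumes "c \<in> UNIV \<rightarrow> carrier R" "d \<in> UNIV \<rightarrow> carrier R"
  shows "lincomb M x I (\<lambda>i. c i \<ominus> d i) = lincomb M x I c \<ominus>\<^bsub>M\<^esub> lincomb M x I d"
  using lincomb_add[of c "\<lambda>i. \<ominus> d i"] lincomb_uminus[of d] assms
  by (simp add: a_minus_def Pi_iff)

lemma lincomb_zero: "lincomb M x I (\<lambda>i. \<zero>) = \<zero>\<^bsub>M\<^esub>"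
  unfolding lincomb_def using x by (intro M.add.finprod_one_eqI) (auto simp: Pi_iff)

lemma lincomb_unit:
  assumes "k \<in> I"
  shows "lincomb M x I (\<lambda>i. if i = k then \<one> else \<zero>) = x k"
proof -
  have "lincomb M x I (\<lambda>i. if i = k then \<one> else \<zero>)
      = finsum M (\<lambda>i. if k = i then x i else \<zero>\<^bsub>M\<^esub>) I"
    unfolding lincomb_def using x by (intro M.finsum_cong') (auto simp: Pi_iff)
  also have "\<dots> = x k"
    using fin x assms by (intro M.finsum_singleton) auto
  finally show ?thesis .
qed

text \<open>This span of the \<open>x i\<close> is the submodule whose inclusion into the whole
  module serves as the test injection for flatness.\<close>

lemma submodule_lincomb: "submodule (lincomb M x I ` (UNIV \<rightarrow> carrier R)) R M"
proof (rule submoduleI)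
  show "\<zero>\<^bsub>M\<^esub> \<in> lincomb M x I ` (UNIV \<rightarrow> carrier R)"
    using lincomb_zero by (intro image_eqI[of _ _ "\<lambda>_. \<zero>"]) auto
  show "\<ominus>\<^bsub>M\<^esub> a \<in> lincomb M x I ` (UNIV \<rightarrow> carrier R)"
    if "a \<in> lincomb M x I ` (UNIV \<rightarrow> carrier R)" for a
  proof -
    from that obtain c where "c \<in> UNIV \<rightarrow> carrier R" "a = lincomb M x I c" by blast
    then show ?thesis
      using lincomb_uminus[of c] by (intro image_eqI[of _ _ "\<lambda>i. \<ominus> c i"]) auto
  qed
  show "a \<oplus>\<^bsub>M\<^esub> b \<in> lincomb M x I ` (UNIV \<rightarrow> carrier R)"
    if "a \<in> lincomb M x I ` (UNIV \<rightarrow> carrier R)" "b \<in> lincomb M x I ` (UNIV \<rightarrow> carrier R)" for a b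
  proof -
    from that obtain c d where "c \<in> UNIV \<rightarrow> carrier R" "a = lincomb M x I c"
      "d \<in> UNIV \<rightarrow> carrier R" "b = lincomb M x I d" by blast
    then show ?thesis
      using lincomb_add[of c d] by (intro image_eqI[of _ _ "\<lambda>i. c i \<oplus> d i"]) auto
  qed
  show "r \<odot>\<^bsub>M\<^esub> a \<in> lincomb M x I ` (UNIV \<rightarrow> carrier R)"
    if "r \<in> carrier R" "a \<in> lincomb M x I ` (UNIV \<rightarrow> carrier R)" for r a
  proof -
    from that obtain c where "c \<in> UNIV \<rightarrow> carrier R" "a = lincomb M x I c" by blast
    then show ?thesis
      using lincomb_smult[of r c] that(1) by (intro image_eqI[of _ _ "\<lambda>i. r \<otimes> c i"]) auto
  qed
qed (use lincomb_closed in auto)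

end

end

section \<open>Annihilators, copies of submodules, spans of syzygies\<close>

lemma (in module) smult_left_commute:
  "\<lbrakk>a \<in> carrier R; b \<in> carrier R; z \<in> carrier M\<rbrakk>
    \<Longrightarrow> a \<odot>\<^bsub>M\<^esub> (b \<odot>\<^bsub>M\<^esub> z) = b \<odot>\<^bsub>M\<^esub> (a \<odot>\<^bsub>M\<^esub> z)"
  by (metis R.m_comm smult_assoc1)

text \<open>Lets \<open>genideal_minimal\<close> pass from generators to the ideal: an element
  killed by generators of a prime is killed by the whole prime.\<close>

lemma (in module) ideal_ann:
  assumes "x \<in> carrier M"
  shows "ideal (ann R M x) R"
proof (rule idealI)
  show "subgroup (ann R M x) (add_monoid R)"
    using assms by unfold_locales
      (auto simp: ann_def smult_l_distr smult_l_minus M.minus_equality simp flip: a_inv_def)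
  fix a r assume "a \<in> ann R M x" "r \<in> carrier R"
  then show "r \<otimes> a \<in> ann R M x" "a \<otimes> r \<in> ann R M x"
    using assms smult_left_commute[of a r x] by (auto simp: ann_def smult_assoc1)
qed (rule R.ring_axioms)

text \<open>
  Moves a submodule of \<open>L\<close> to another element type, because \<^const>\<open>flat_module\<close> only tests modules
  over one fixed type. The additive inverse image under \<open>\<iota>\<close> makes sense only for injective \<open>\<iota>\<close>.
\<close>

definition transport_module :: "('l \<Rightarrow> 'n) \<Rightarrow> ('r, 'l, 'y) module_scheme \<Rightarrow> 'l set \<Rightarrow> ('r, 'n) module"
  where "transport_module \<iota> L B =
    \<lparr>carrier = \<iota> ` B, monoid.mult = undefined, one = undefined, zero = \<iota> \<zero>\<^bsub>L\<^esub>,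
     add = (\<lambda>a b. \<iota> (inv_into UNIV \<iota> a \<oplus>\<^bsub>L\<^esub> inv_into UNIV \<iota> b)),
     smult = (\<lambda>r a. \<iota> (r \<odot>\<^bsub>L\<^esub> inv_into UNIV \<iota> a))\<rparr>"

lemma (in module) module_transport_module:
  assumes "inj \<iota>" and B: "submodule B R M"
  shows "module R (transport_module \<iota> M B)"
proof -
  have [simp]: "inv_into UNIV \<iota> (\<iota> z) = z" for z
    using assms(1) by simp
  have [simp]: "z \<in> carrier M" if "z \<in> B" for z
    using submoduleE(1)[OF B] that by blast
  have [simp]: "\<zero>\<^bsub>M\<^esub> \<in> B"
    using subgroup.one_closed[OF submodule.axioms(1)[OF B]] by simp
  note closed = submoduleE(3-5)[OF B]
  show ?thesis
  proof (rule moduleI)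
    show "abelian_group (transport_module \<iota> M B)"
    proof (rule abelian_groupI)
      fix a assume "a \<in> carrier (transport_module \<iota> M B)"
      then obtain z where "z \<in> B" "a = \<iota> z" by (auto simp: transport_module_def)
      then show "\<exists>y\<in>carrier (transport_module \<iota> M B).
          y \<oplus>\<^bsub>transport_module \<iota> M B\<^esub> a = \<zero>\<^bsub>transport_module \<iota> M B\<^esub>"
        by (intro bexI[of _ "\<iota> (\<ominus>\<^bsub>M\<^esub> z)"])
          (auto simp: transport_module_def closed M.l_neg)
    qed (auto simp: transport_module_def closed M.a_ac)
  qed (auto simp: transport_module_def closed smult_l_distr smult_r_distr smult_assoc1 R.is_cring)
qed

text \<open>
  The image of \<open>K \<otimes> M\<close> in \<open>M\<^sup>I\<close>, where \<open>K\<close> is the module of relations between the \<open>x i\<close>. Values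
  and coefficients at indices outside \<open>I\<close> are irrelevant.
\<close>

inductive_set syzygy_span ::
    "('r, 'x) ring_scheme \<Rightarrow> ('r, 'l, 'y) module_scheme \<Rightarrow> ('r, 'm, 'z) module_scheme
      \<Rightarrow> ('i \<Rightarrow> 'l) \<Rightarrow> 'i set \<Rightarrow> ('i \<Rightarrow> 'm) set"
  for R L M x I where
  zero: "(\<lambda>_. \<zero>\<^bsub>M\<^esub>) \<in> syzygy_span R L M x I"
| step: "\<lbrakk>u \<in> syzygy_span R L M x I; d \<in> UNIV \<rightarrow> carrier R; lincomb L x I d = \<zero>\<^bsub>L\<^esub>;
          w \<in> carrier M\<rbrakk> \<Longrightarrow> (\<lambda>i. u i \<oplus>\<^bsub>M\<^esub> d i \<odot>\<^bsub>M\<^esub> w) \<in> syzygy_span R L M x I"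

context tensor
begin

lemma syzygy_span_closed: "u \<in> syzygy_span R L M x I \<Longrightarrow> u i \<in> carrier M"
  by (induction rule: syzygy_span.induct) auto

text \<open>Since \<open>step\<close> appends one term at a time, induction on the second summand
  followed by reassociation suffices.\<close>

lemma syzygy_span_add:
  assumes "u \<in> syzygy_span R L M x I" "v \<in> syzygy_span R L M x I"
  shows "(\<lambda>i. u i \<oplus>\<^bsub>M\<^esub> v i) \<in> syzygy_span R L M x I"
  using assms(2)
proof (induction rule: syzygy_span.induct)
  case zero
  then show ?case
    using assms(1) syzygy_span_closed[OF assms(1)] by simp
next
  case (step v d w)
  have "(\<lambda>i. u i \<oplus>\<^bsub>M\<^esub> (v i \<oplus>\<^bsub>M\<^esub> d i \<odot>\<^bsub>M\<^esub> w)) = (\<lambda>i. (u i \<oplus>\<^bsub>M\<^esub> v i) \<oplus>\<^bsub>M\<^esub> d i \<odot>\<^bsub>M\<^esub> w)"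
    using step syzygy_span_closed[OF assms(1)] syzygy_span_closed[OF step(1)]
    by (auto simp: M.M.a_assoc Pi_iff)
  then show ?case
    using syzygy_span.step[OF step(5,2-4)] by simp
qed

text \<open>The sign is absorbed into the module element \<open>w\<close>, so the same syzygies
  \<open>d\<close> can be reused.\<close>

lemma syzygy_span_uminus:
  assumes "u \<in> syzygy_span R L M x I"
  shows "(\<lambda>i. \<ominus>\<^bsub>M\<^esub> u i) \<in> syzygy_span R L M x I"
  using assms
proof (induction rule: syzygy_span.induct)
  case zero
  have "\<ominus>\<^bsub>M\<^esub> \<zero>\<^bsub>M\<^esub> = \<zero>\<^bsub>M\<^esub>"
    by (rule M.M.minus_equality) auto
  then show ?case
    by (simp only: syzygy_span.zero)
next
  case (step u d w)
  have "(\<lambda>i. \<ominus>\<^bsub>M\<^esub> (u i \<oplus>\<^bsub>M\<^esub> d i \<odot>\<^bsub>M\<^esub> w)) = (\<lambda>i. \<ominus>\<^bsub>M\<^esub> u i \<oplus>\<^bsub>M\<^esub> d i \<odot>\<^bsub>M\<^esub> (\<ominus>\<^bsub>M\<^esub> w))"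
    using step syzygy_span_closed[OF step(1)]
    by (auto simp: M.M.minus_add M.smult_r_minus Pi_iff)
  then show ?case
    using syzygy_span.step[OF step(5,2,3), of "\<ominus>\<^bsub>M\<^esub> w"] step(4) by simp
qed

lemma syzygy_span_smult:
  assumes "d \<in> UNIV \<rightarrow> carrier R" "lincomb L x I d = \<zero>\<^bsub>L\<^esub>" "w \<in> carrier M"
  shows "(\<lambda>i. d i \<odot>\<^bsub>M\<^esub> w) \<in> syzygy_span R L M x I"
  using syzygy_span.step[OF syzygy_span.zero assms] assms by (simp add: Pi_iff)

end

lemma (in module) submodule_carrier: "submodule (carrier M) R M"
  by (rule submoduleI) auto

lemma (in module) id_module_hom: "id \<in> module_hom R M M"
  by (simp add: module_hom_def)

lemma (in module) smult_l_diff: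
  "\<lbrakk>a \<in> carrier R; b \<in> carrier R; z \<in> carrier M\<rbrakk> \<Longrightarrow> (a \<ominus> b) \<odot>\<^bsub>M\<^esub> z = a \<odot>\<^bsub>M\<^esub> z \<ominus>\<^bsub>M\<^esub> b \<odot>\<^bsub>M\<^esub> z"
  by (simp add: a_minus_def smult_l_distr smult_l_minus)

section \<open>Flatness turns vanishing tensors into syzygies\<close>

context tensor
begin

text \<open>Flatness is applied to the inclusion of \<open>B\<close> into \<open>L\<close>, both
  copied along \<open>\<iota>\<close>. The copy of \<open>F\<close> vanishes over the copy of
  \<open>L\<close> by functoriality, so the class of \<open>F\<close> over the copy of
  \<open>B\<close> has the same image as zero, and injectivity makes it zero.\<close>

lemma flat_submodule:
  fixes \<iota> :: "'l \<Rightarrow> 'n"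
  assumes flat: "flat_module TYPE('n) R M" and "inj \<iota>" and B: "submodule B R L"
    and F: "F \<in> tensor_null R L M" "Poly_Mapping.keys F \<subseteq> B \<times> carrier M"
  shows "frag_map2 \<iota> id F \<in> tensor_null R (transport_module \<iota> L B) M"
proof -
  let ?N = "transport_module \<iota> L B" and ?N' = "transport_module \<iota> L (carrier L)"
  have [simp]: "inv_into UNIV \<iota> (\<iota> z) = z" for z
    using \<open>inj \<iota>\<close> by simp
  have BL: "B \<subseteq> carrier L"
    using L.submoduleE(1)[OF B] .
  interpret N: tensor R ?N M
    using L.module_transport_module[OF \<open>inj \<iota>\<close> B] M.module_axioms by (simp add: tensor_def)
  interpret N': tensor R ?N' M
    using L.module_transport_module[OF \<open>inj \<iota>\<close> L.submodule_carrier] M.module_axioms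
    by (simp add: tensor_def)
  have hom: "\<iota> \<in> module_hom R L ?N'"
    by (auto simp: module_hom_def transport_module_def)
  \<comment> \<open>Both copies use the same \<open>\<iota>\<close>, so the inclusion of
    \<open>B\<close> becomes the identity on elements.\<close>
  have id: "id \<in> module_hom R ?N ?N'"
    using BL by (auto simp: module_hom_def transport_module_def)
  let ?F = "frag_map2 \<iota> id F"
  have keys: "Poly_Mapping.keys ?F \<subseteq> carrier ?N \<times> carrier M"
    using F(2) by (intro order_trans[OF keys_frag_extend]) (fastforce simp: transport_module_def)
  have F': "?F \<in> tensor_null R ?N' M"
    by (rule frag_map2_null[OF tensor_axioms N'.tensor_axioms hom M.id_module_hom F(1)])
  have map: "tensor_map R ?N' M id id (tensor_null R ?N M #>\<^bsub>tensor_free ?N M\<^esub> G) =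
      tensor_null R ?N' M #>\<^bsub>tensor_free ?N' M\<^esub> G" for G
  proof -
    have "frag_map2 id id G = G"
      by (metis (no_types, lifting) case_prod_conv frag_expansion frag_extend_eq id_apply surj_pair)
    then show ?thesis
      using tensor_map_coset[OF N.tensor_axioms N'.tensor_axioms id M.id_module_hom, of G] by simp
  qed
  have "inj_on (tensor_map R ?N' M id id) (tensor_carrier R ?N M)"
    using flat N.L.module_axioms N'.L.module_axioms id inj_on_id[of "carrier ?N"]
    unfolding flat_module_def by blast
  moreover have "tensor_null R ?N M #>\<^bsub>tensor_free ?N M\<^esub> G \<in> tensor_carrier R ?N M"
    if "Poly_Mapping.keys G \<subseteq> carrier ?N \<times> carrier M" for G
    using that unfolding tensor_carrier_def RCOSETS_def by (auto simp: tensor_free_def)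
  moreover have "Poly_Mapping.keys ?F \<subseteq> carrier ?N' \<times> carrier M"
    using keys BL by (auto simp: transport_module_def)
  then have "tensor_null R ?N' M #>\<^bsub>tensor_free ?N' M\<^esub> ?F = tensor_null R ?N' M #>\<^bsub>tensor_free ?N' M\<^esub> 0"
    using N'.coset_eq_null_iff[of 0] N'.coset_eq_null_iff[of ?F] F' by simp
  ultimately have "tensor_null R ?N M #>\<^bsub>tensor_free ?N M\<^esub> ?F = tensor_null R ?N M #>\<^bsub>tensor_free ?N M\<^esub> 0"
    using keys by (simp add: inj_on_def map)
  then show ?thesis
    using N.coset_eq_null_iff[of 0] N.coset_eq_null_iff[of ?F] keys by simp
qed

text \<open>
  With \<open>N\<close> the span of the \<open>x i\<close>, flatness makes \<open>\<Sum> x i \<otimes> m i\<close> vanish already in \<open>N \<otimes> M\<close>. Choosing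
  coefficients \<open>c y\<close> for every \<open>y \<in> N\<close>, the map \<open>y \<otimes> w \<mapsto> (c y i w)\<^sub>i\<close> is well defined modulo
  the span of the syzygies, and sends \<open>\<Sum> x i \<otimes> m i\<close> to the class of \<open>m\<close>.
\<close>

lemma flat_criterion:
  fixes \<iota> :: "'l \<Rightarrow> 'n" and x :: "'i \<Rightarrow> 'l"
  assumes flat: "flat_module TYPE('n) R M" and "inj \<iota>"
    and I: "finite I" "x \<in> I \<rightarrow> carrier L" "m \<in> I \<rightarrow> carrier M"
    and null: "(\<Sum>i\<in>I. frag_of (x i, m i)) \<in> tensor_null R L M"
  obtains u where "u \<in> syzygy_span R L M x I" "\<And>i. i \<in> I \<Longrightarrow> u i = m i"
proof -
  define C where "C = (UNIV :: 'i set) \<rightarrow> carrier R"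
  define B where "B = lincomb L x I ` C"
  define N where "N = transport_module \<iota> L B"
  let ?T = "syzygy_span R L M x I"
  note lc = L.lincomb_closed[OF I(1,2), folded C_def] L.lincomb_add[OF I(1,2), folded C_def]
    L.lincomb_smult[OF I(1,2), folded C_def] L.lincomb_minus[OF I(1,2), folded C_def]
  have [simp]: "inv_into UNIV \<iota> (\<iota> z) = z" for z
    using \<open>inj \<iota>\<close> by simp
  have B: "submodule B R L"
    unfolding B_def C_def by (rule L.submodule_lincomb[OF I(1,2)])
  interpret N: tensor R N M
    using L.module_transport_module[OF \<open>inj \<iota>\<close> B] M.module_axioms by (simp add: tensor_def N_def)
  have "\<exists>c. c \<in> C \<and> \<iota> (lincomb L x I c) = y" if "y \<in> carrier N" for y
    using that by (auto simp: N_def transport_module_def B_def)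
  \<comment> \<open>An arbitrary choice of coefficients, with no linearity in \<open>y\<close>. Its
    failure to be linear will be measured by syzygies.\<close>
  then obtain c where c: "\<And>y. y \<in> carrier N \<Longrightarrow> c y \<in> C"
      and "\<And>y. y \<in> carrier N \<Longrightarrow> \<iota> (lincomb L x I (c y)) = y"
    by metis
  then have lc_c: "lincomb L x I (c y) = inv_into UNIV \<iota> y" if "y \<in> carrier N" for y
    using that by (metis \<open>inj \<iota>\<close> inv_f_f)
  have cR: "c y i \<in> carrier R" if "y \<in> carrier N" for y i
    using c[OF that] by (auto simp: C_def)
  let ?Fr = "free_Abelian_group (carrier N \<times> carrier M)"
  \<comment> \<open>\<open>h i\<close> is the i-th coordinate of the map announced above, defined on
    the free group by its universal property.\<close>
  have "\<exists>h. h \<in> hom ?Fr (add_monoid M) \<and>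
      (\<forall>y\<in>carrier N. \<forall>w\<in>carrier M. h (frag_of (y, w)) = c y i \<odot>\<^bsub>M\<^esub> w)" for i
  proof -
    have "(\<lambda>(y, w). c y i \<odot>\<^bsub>M\<^esub> w) ` (carrier N \<times> carrier M) \<subseteq> carrier (add_monoid M)"
      using cR by auto
    from comm_group.free_Abelian_group_universal[OF M.M.a_comm_group this]
    show ?thesis by (metis (no_types, lifting) SigmaI case_prod_conv)
  qed
  then obtain h where h: "\<And>i. h i \<in> hom ?Fr (add_monoid M)"
    and h_of: "\<And>i y w. y \<in> carrier N \<Longrightarrow> w \<in> carrier M \<Longrightarrow> h i (frag_of (y, w)) = c y i \<odot>\<^bsub>M\<^esub> w"
    by metis
  have gh: "group_hom ?Fr (add_monoid M) (h i)" for i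
    using h M.M.a_group by (simp add: group_hom_def group_hom_axioms_def)
  let ?K = "\<lambda>F. Poly_Mapping.keys F \<subseteq> carrier N \<times> carrier M"
  have h_zero: "h i 0 = \<zero>\<^bsub>M\<^esub>" for i
    using group_hom.hom_one[OF gh[of i]] by simp
  have h_add: "h i (F + G) = h i F \<oplus>\<^bsub>M\<^esub> h i G" if "?K F" "?K G" for i F G
    using group_hom.hom_mult[OF gh[of i], of F G] that by simp
  have h_uminus: "h i (- F) = \<ominus>\<^bsub>M\<^esub> h i F" if "?K F" for i F
    using group_hom.hom_inv[OF gh[of i], of F] that by (simp add: a_inv_def)
  have h_diff: "h i (F - G) = h i F \<ominus>\<^bsub>M\<^esub> h i G" if "?K F" "?K G" for i F G
    using h_add[of F "- G" i] h_uminus[of G i] that by (simp add: a_minus_def)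
  have h_closed: "h i F \<in> carrier M" if "?K F" for i F
    using group_hom.hom_closed[OF gh[of i], of F] that by simp
  have null_T: "(\<lambda>i. h i F) \<in> ?T" if "F \<in> tensor_null R N M" for F
  proof -
    \<comment> \<open>The support condition \<open>?K\<close> is carried through the induction
      because \<open>h i\<close> is a homomorphism only on the carrier of the free group.\<close>
    have "F \<in> {F. ?K F \<and> (\<lambda>i. h i F) \<in> ?T}"
    proof (rule N.tensor_null_minimal[OF that])
      fix G assume G: "G \<in> tensor_relators R N M"
      then have "G \<in> carrier (tensor_free N M)"
        using N.tensor_relators_subset by blast
      then have "?K G"
        by (simp add: tensor_free_def)
      moreover have "(\<lambda>i. h i G) \<in> ?T"
        using G unfolding tensor_relators_def
      proof (elim UnE CollectE exE conjE)
        fix y y' w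
        assume *: "y \<in> carrier N" "y' \<in> carrier N" "w \<in> carrier M"
          and G: "G = frag_of (y \<oplus>\<^bsub>N\<^esub> y', w) - frag_of (y, w) - frag_of (y', w)"
        obtain a b where ab: "a \<in> carrier L" "b \<in> carrier L" "y = \<iota> a" "y' = \<iota> b"
          using * L.submoduleE(1)[OF B] by (auto simp: N_def transport_module_def)
        have yy': "y \<oplus>\<^bsub>N\<^esub> y' = \<iota> (a \<oplus>\<^bsub>L\<^esub> b)"
          by (simp add: N_def transport_module_def ab)
        have yN: "y \<oplus>\<^bsub>N\<^esub> y' \<in> carrier N"
          using * by simp
        \<comment> \<open>\<open>d\<close> is the additivity defect of the choice \<open>c\<close>.
          It is a syzygy because both ways of choosing coefficients represent the same element a + b
          of \<open>L\<close>.\<close>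
        define d' where "d' = (\<lambda>i. c (y \<oplus>\<^bsub>N\<^esub> y') i \<ominus>\<^bsub>R\<^esub> c y i)"
        define d where "d = (\<lambda>i. d' i \<ominus>\<^bsub>R\<^esub> c y' i)"
        have d': "d' \<in> C" "d \<in> C"
          using * cR yN by (auto simp: C_def d'_def d_def)
        have "lincomb L x I d = (a \<oplus>\<^bsub>L\<^esub> b) \<ominus>\<^bsub>L\<^esub> a \<ominus>\<^bsub>L\<^esub> b"
          unfolding d_def lc(4)[OF d'(1) c[OF *(2)]] unfolding d'_def lc(4)[OF c[OF yN] c[OF *(1)]]
          unfolding lc_c[OF yN] lc_c[OF *(1)] lc_c[OF *(2)] unfolding yy' by (simp add: ab)
        also have "\<dots> = \<zero>\<^bsub>L\<^esub>"
          using ab by (simp add: a_minus_def L.M.a_assoc L.M.a_lcomm[of b] L.M.r_neg)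
        finally have "lincomb L x I d = \<zero>\<^bsub>L\<^esub>" .
        then have "(\<lambda>i. d i \<odot>\<^bsub>M\<^esub> w) \<in> ?T"
          using d' * by (intro syzygy_span_smult) (auto simp: C_def)
        moreover have "h i G = d i \<odot>\<^bsub>M\<^esub> w" for i
        proof -
          have "h i G = c (y \<oplus>\<^bsub>N\<^esub> y') i \<odot>\<^bsub>M\<^esub> w \<ominus>\<^bsub>M\<^esub> c y i \<odot>\<^bsub>M\<^esub> w \<ominus>\<^bsub>M\<^esub> c y' i \<odot>\<^bsub>M\<^esub> w"
            unfolding G using * yN keys_diff[of "frag_of (y \<oplus>\<^bsub>N\<^esub> y', w)" "frag_of (y, w)"]
            by (subst h_diff h_of | fastforce)+
          then show ?thesis
            using * yN d' cR by (simp add: d_def d'_def M.smult_l_diff)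
        qed
        ultimately show ?thesis by simp
      next
        fix y w w'
        assume *: "y \<in> carrier N" "w \<in> carrier M" "w' \<in> carrier M"
          and G: "G = frag_of (y, w \<oplus>\<^bsub>M\<^esub> w') - frag_of (y, w) - frag_of (y, w')"
        \<comment> \<open>Here the coefficient \<open>c y i\<close> is the same in all three terms,
          so distributivity gives exactly zero.\<close>
        have "h i G = \<zero>\<^bsub>M\<^esub>" for i
        proof -
          have "h i G = c y i \<odot>\<^bsub>M\<^esub> (w \<oplus>\<^bsub>M\<^esub> w') \<ominus>\<^bsub>M\<^esub> c y i \<odot>\<^bsub>M\<^esub> w \<ominus>\<^bsub>M\<^esub> c y i \<odot>\<^bsub>M\<^esub> w'"
            unfolding G using * keys_diff[of "frag_of (y, w \<oplus>\<^bsub>M\<^esub> w')" "frag_of (y, w)"]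
            by (subst h_diff h_of | fastforce)+
          then show ?thesis
            using * cR by (simp add: a_minus_def M.smult_r_distr M.M.a_ac M.M.r_neg M.M.r_neg1)
        qed
        then show ?thesis
          using syzygy_span.zero[of M R L x I] by simp
      next
        fix r y w
        assume *: "r \<in> carrier R" "y \<in> carrier N" "w \<in> carrier M"
          and G: "G = frag_of (r \<odot>\<^bsub>N\<^esub> y, w) - frag_of (y, r \<odot>\<^bsub>M\<^esub> w)"
        obtain a where a: "a \<in> carrier L" "y = \<iota> a"
          using * L.submoduleE(1)[OF B] by (auto simp: N_def transport_module_def)
        have ry: "r \<odot>\<^bsub>N\<^esub> y = \<iota> (r \<odot>\<^bsub>L\<^esub> a)"
          by (simp add: N_def transport_module_def a)
        have yN: "r \<odot>\<^bsub>N\<^esub> y \<in> carrier N"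
          using * by simp
        \<comment> \<open>Now \<open>d\<close> is the defect of compatibility with multiplication by
          \<open>r\<close>: two coefficient families for the same element r a.\<close>
        define d' where "d' = (\<lambda>i. r \<otimes>\<^bsub>R\<^esub> c y i)"
        define d where "d = (\<lambda>i. c (r \<odot>\<^bsub>N\<^esub> y) i \<ominus>\<^bsub>R\<^esub> d' i)"
        have d': "d' \<in> C" "d \<in> C"
          using * cR yN by (auto simp: C_def d'_def d_def)
        have "lincomb L x I d = r \<odot>\<^bsub>L\<^esub> a \<ominus>\<^bsub>L\<^esub> r \<odot>\<^bsub>L\<^esub> a"
          unfolding d_def lc(4)[OF c[OF yN] d'(1)] unfolding d'_def lc(3)[OF *(1) c[OF *(2)]]
          unfolding lc_c[OF yN] lc_c[OF *(2)] unfolding ry by (simp add: a)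
        also have "\<dots> = \<zero>\<^bsub>L\<^esub>"
          using a * by (simp add: a_minus_def L.M.r_neg)
        finally have "lincomb L x I d = \<zero>\<^bsub>L\<^esub>" .
        then have "(\<lambda>i. d i \<odot>\<^bsub>M\<^esub> w) \<in> ?T"
          using d' * by (intro syzygy_span_smult) (auto simp: C_def)
        moreover have "h i G = d i \<odot>\<^bsub>M\<^esub> w" for i
        proof -
          have "h i G = c (r \<odot>\<^bsub>N\<^esub> y) i \<odot>\<^bsub>M\<^esub> w \<ominus>\<^bsub>M\<^esub> c y i \<odot>\<^bsub>M\<^esub> (r \<odot>\<^bsub>M\<^esub> w)"
            unfolding G using * yN by (subst h_diff h_of | fastforce)+
          also have "c y i \<odot>\<^bsub>M\<^esub> (r \<odot>\<^bsub>M\<^esub> w) = d' i \<odot>\<^bsub>M\<^esub> w"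
            using * cR by (simp add: d'_def L.R.m_comm flip: M.smult_assoc1)
          finally show ?thesis
            using * yN d' cR by (simp add: d_def C_def Pi_iff M.smult_l_diff)
        qed
        ultimately show ?thesis by simp
      qed
      ultimately show "G \<in> {F. ?K F \<and> (\<lambda>i. h i F) \<in> ?T}" by blast
    next
      show "0 \<in> {F. ?K F \<and> (\<lambda>i. h i F) \<in> ?T}"
        by (simp add: h_zero syzygy_span.zero)
    next
      show "- G \<in> {F. ?K F \<and> (\<lambda>i. h i F) \<in> ?T}" if "G \<in> {F. ?K F \<and> (\<lambda>i. h i F) \<in> ?T}" for G
        using that syzygy_span_uminus by (auto simp: h_uminus)
    next
      show "G + G' \<in> {F. ?K F \<and> (\<lambda>i. h i F) \<in> ?T}"
        if "G \<in> {F. ?K F \<and> (\<lambda>i. h i F) \<in> ?T}" "G' \<in> {F. ?K F \<and> (\<lambda>i. h i F) \<in> ?T}" for G G'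
        using that syzygy_span_add keys_add[of G G'] by (auto simp: h_add)
    qed
    then show ?thesis by simp
  qed
  \<comment> \<open>\<open>?u J\<close> is the family \<open>m\<close> cut off outside
    \<open>J\<close>, and \<open>?e k\<close> is the k-th unit vector of coefficients.\<close>
  let ?u = "\<lambda>J i. if i \<in> J then m i else \<zero>\<^bsub>M\<^esub>"
  let ?e = "\<lambda>k i. if i = k then \<one>\<^bsub>R\<^esub> else \<zero>\<^bsub>R\<^esub>"
  have xN: "\<iota> (x k) \<in> carrier N" if "k \<in> I" for k
    using L.lincomb_unit[OF I(1,2) that]
    by (auto simp: N_def transport_module_def B_def C_def intro!: image_eqI[of _ _ "?e k"])
  have KF: "?K (\<Sum>i\<in>J. frag_of (\<iota> (x i), m i))" if "J \<subseteq> I" for J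
    using that xN I(3) by (intro order_trans[OF keys_sum]) (auto simp: Pi_iff)
  \<comment> \<open>Modulo syzygies the map sends the partial sum over \<open>J\<close> to
    \<open>m\<close> cut off to \<open>J\<close>. A new index \<open>k\<close> contributes the
    chosen coefficients of \<open>x k\<close> minus the unit vector \<open>?e k\<close>, a syzygy
    since both represent \<open>x k\<close>.\<close>
  have partial: "(\<lambda>i. h i (\<Sum>i\<in>J. frag_of (\<iota> (x i), m i)) \<ominus>\<^bsub>M\<^esub> ?u J i) \<in> ?T"
    if "finite J" "J \<subseteq> I" for J
    using that
  proof (induction J rule: finite_induct)
    case empty
    have "\<zero>\<^bsub>M\<^esub> \<ominus>\<^bsub>M\<^esub> \<zero>\<^bsub>M\<^esub> = \<zero>\<^bsub>M\<^esub>"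
      by (simp add: a_minus_def M.M.r_neg)
    then show ?case
      using syzygy_span.zero[of M R L x I] by (simp add: h_zero)
  next
    case (insert k J)
    let ?G = "\<Sum>i\<in>J. frag_of (\<iota> (x i), m i)"
    have k: "k \<in> I" "m k \<in> carrier M" and J: "J \<subseteq> I"
      using insert I by auto
    define d where "d = (\<lambda>i. c (\<iota> (x k)) i \<ominus>\<^bsub>R\<^esub> ?e k i)"
    have e: "?e k \<in> C" and d: "d \<in> C"
      using cR[OF xN[OF k(1)]] by (auto simp: C_def d_def)
    have "x k \<in> carrier L"
      using I k by auto
    then have "lincomb L x I d = \<zero>\<^bsub>L\<^esub>"
      unfolding d_def lc(4)[OF c[OF xN[OF k(1)]] e] lc_c[OF xN[OF k(1)]] L.lincomb_unit[OF I(1,2) k(1)]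
      by (simp add: a_minus_def L.M.r_neg)
    then have "(\<lambda>i. (h i ?G \<ominus>\<^bsub>M\<^esub> ?u J i) \<oplus>\<^bsub>M\<^esub> d i \<odot>\<^bsub>M\<^esub> m k) \<in> ?T"
      using insert d k by (intro syzygy_span.step) (auto simp: C_def)
    moreover have "h i (\<Sum>i\<in>insert k J. frag_of (\<iota> (x i), m i)) \<ominus>\<^bsub>M\<^esub> ?u (insert k J) i
        = (h i ?G \<ominus>\<^bsub>M\<^esub> ?u J i) \<oplus>\<^bsub>M\<^esub> d i \<odot>\<^bsub>M\<^esub> m k" for i
    proof -
      have "h i (\<Sum>i\<in>insert k J. frag_of (\<iota> (x i), m i)) = c (\<iota> (x k)) i \<odot>\<^bsub>M\<^esub> m k \<oplus>\<^bsub>M\<^esub> h i ?G"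
        using insert k KF[OF J] xN by (simp add: h_add h_of)
      moreover have "c (\<iota> (x k)) i \<odot>\<^bsub>M\<^esub> m k \<in> carrier M" "h i ?G \<in> carrier M" "?u J i \<in> carrier M"
        using cR xN k h_closed KF[OF J] I J by auto
      moreover have "d i \<odot>\<^bsub>M\<^esub> m k = c (\<iota> (x k)) i \<odot>\<^bsub>M\<^esub> m k \<ominus>\<^bsub>M\<^esub> (if i = k then m k else \<zero>\<^bsub>M\<^esub>)"
        unfolding d_def using cR xN k by (simp add: M.smult_l_diff)
      ultimately show ?thesis
        using insert(2) k
        by (cases "i = k") (auto simp: a_minus_def M.M.a_ac M.M.minus_equality[of "\<zero>\<^bsub>M\<^esub>" "\<zero>\<^bsub>M\<^esub>"])
    qed
    ultimately show ?case by simp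
  qed
  have "frag_map2 \<iota> id (\<Sum>i\<in>I. frag_of (x i, m i)) \<in> tensor_null R N M"
    unfolding N_def
  proof (rule flat_submodule[OF flat \<open>inj \<iota>\<close> B null])
    have "x k \<in> B" if "k \<in> I" for k
      using xN[OF that] \<open>inj \<iota>\<close> by (auto simp: N_def transport_module_def inj_image_mem_iff)
    then show "Poly_Mapping.keys (\<Sum>i\<in>I. frag_of (x i, m i)) \<subseteq> B \<times> carrier M"
      using I(3) by (intro order_trans[OF keys_sum]) (auto simp: Pi_iff)
  qed
  then have "(\<Sum>i\<in>I. frag_of (\<iota> (x i), m i)) \<in> tensor_null R N M"
    by (simp add: frag_extend_sum I(1) comp_def)
  \<comment> \<open>The image of the full sum is in the span because the sum vanishes over the span
    of the \<open>x i\<close>. Subtracting its difference from \<open>m\<close>, also in the span,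
    leaves \<open>m\<close> on \<open>I\<close>.\<close>
  note T = syzygy_span_add[OF null_T[OF this] syzygy_span_uminus[OF partial[OF I(1) subset_refl]]]
  show thesis
  proof (rule that[OF T])
    fix i assume "i \<in> I"
    have "h i (\<Sum>i\<in>I. frag_of (\<iota> (x i), m i)) \<in> carrier M" "m i \<in> carrier M"
      using h_closed[OF KF[OF subset_refl]] I \<open>i \<in> I\<close> by auto
    then show "h i (\<Sum>i\<in>I. frag_of (\<iota> (x i), m i)) \<oplus>\<^bsub>M\<^esub>
        \<ominus>\<^bsub>M\<^esub> (h i (\<Sum>i\<in>I. frag_of (\<iota> (x i), m i)) \<ominus>\<^bsub>M\<^esub> ?u I i) = m i"
      using \<open>i \<in> I\<close>
      by (simp add: a_minus_def M.M.minus_add M.M.r_neg1 flip: M.M.a_assoc)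
        (simp add: M.M.r_neg M.M.a_assoc)
  qed
qed

end

section \<open>Tensors annihilated by an ideal\<close>

lemma (in module) lincomb_smult_family:
  assumes "finite I" "x \<in> I \<rightarrow> carrier M" "a \<in> carrier R" "c \<in> UNIV \<rightarrow> carrier R"
  shows "lincomb M (\<lambda>i. a \<odot>\<^bsub>M\<^esub> x i) I c = a \<odot>\<^bsub>M\<^esub> lincomb M x I c"
proof -
  have "a \<odot>\<^bsub>M\<^esub> lincomb M x I c = finsum M (\<lambda>i. a \<odot>\<^bsub>M\<^esub> (c i \<odot>\<^bsub>M\<^esub> x i)) I"
    unfolding lincomb_def using assms by (intro finsum_smult_ldistr) (auto simp: Pi_iff)
  also have "\<dots> = lincomb M (\<lambda>i. a \<odot>\<^bsub>M\<^esub> x i) I c"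
    unfolding lincomb_def using assms
    by (intro M.finsum_cong') (auto simp: Pi_iff intro!: smult_left_commute)
  finally show ?thesis by simp
qed

lemma (in module) lincomb_eq_zero:
  assumes "x \<in> I \<rightarrow> {\<zero>\<^bsub>M\<^esub>}" "c \<in> UNIV \<rightarrow> carrier R"
  shows "lincomb M x I c = \<zero>\<^bsub>M\<^esub>"
  unfolding lincomb_def using assms by (intro M.add.finprod_one_eqI) (auto simp: Pi_iff)

lemma (in module) lincomb_insert:
  assumes "finite X" "y \<notin> X" "insert y X \<subseteq> carrier M" "c \<in> UNIV \<rightarrow> carrier R"
  shows "lincomb M id (insert y X) c = c y \<odot>\<^bsub>M\<^esub> y \<oplus>\<^bsub>M\<^esub> lincomb M id X c"
  using assms by (simp add: lincomb_def M.finsum_insert Pi_iff subset_iff)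

context tensor
begin

lemma teq_lincomb:
  assumes "finite Y" "Y \<subseteq> carrier L" "d \<in> UNIV \<rightarrow> carrier R" "w \<in> carrier M"
  shows "(\<Sum>y\<in>Y. frag_of (y, d y \<odot>\<^bsub>M\<^esub> w)) \<doteq> frag_of (lincomb L id Y d, w)"
proof -
  have "frag_of (lincomb L id Y d, w) \<doteq> (\<Sum>y\<in>Y. frag_of (d y \<odot>\<^bsub>L\<^esub> id y, w))"
    unfolding lincomb_def using assms by (intro teq_finsum_left) auto
  also have "\<dots> \<doteq> (\<Sum>y\<in>Y. frag_of (y, d y \<odot>\<^bsub>M\<^esub> w))"
    using assms by (auto intro!: teq_sum teq_smult)
  finally show ?thesis by (rule teq_sym)
qed

lemma teq_sum_add_right:
  assumes "Y \<subseteq> carrier L" "u \<in> Y \<rightarrow> carrier M" "v \<in> Y \<rightarrow> carrier M"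
  shows "(\<Sum>y\<in>Y. frag_of (y, u y \<oplus>\<^bsub>M\<^esub> v y)) \<doteq> (\<Sum>y\<in>Y. frag_of (y, u y)) + (\<Sum>y\<in>Y. frag_of (y, v y))"
proof -
  have "(\<Sum>y\<in>Y. frag_of (y, u y \<oplus>\<^bsub>M\<^esub> v y)) \<doteq> (\<Sum>y\<in>Y. frag_of (y, u y) + frag_of (y, v y))"
    using assms by (intro teq_sum teq_add_right) auto
  then show ?thesis by (simp add: sum.distrib)
qed

text \<open>For a submodule \<open>B\<close> these formal sums represent the image of B \<otimes> M
  in L \<otimes> M. Terms are grouped by first component, so a tensor is given by a finite set of
  distinct elements with one coefficient each, ready for induction on that set.\<close>

definition tspan :: "'l set \<Rightarrow> ('l \<times> 'm \<Rightarrow>\<^sub>0 int) set"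
  where "tspan B = {F. \<exists>Y m. finite Y \<and> Y \<subseteq> B \<and> m \<in> Y \<rightarrow> carrier M \<and> F \<doteq> (\<Sum>y\<in>Y. frag_of (y, m y))}"

lemma tspan_teq: "F \<in> tspan B \<Longrightarrow> F \<doteq> G \<Longrightarrow> G \<in> tspan B"
  unfolding tspan_def by (blast intro: teq_trans[OF teq_sym])

lemma tspan_zero: "0 \<in> tspan B"
  unfolding tspan_def by (auto intro!: exI[of _ "{}"])

lemma tspan_add_frag_of:
  assumes "B \<subseteq> carrier L" "F \<in> tspan B" "b \<in> B" "w \<in> carrier M"
  shows "F + frag_of (b, w) \<in> tspan B"
proof -
  obtain Y m where Y: "finite Y" "Y \<subseteq> B" "m \<in> Y \<rightarrow> carrier M" "F \<doteq> (\<Sum>y\<in>Y. frag_of (y, m y))"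
    using assms(2) unfolding tspan_def by blast
  \<comment> \<open>If \<open>b\<close> already occurs, its coefficient is merged with
    \<open>w\<close>; otherwise \<open>b\<close> is a new term with coefficient
    \<open>w\<close>.\<close>
  let ?m = "\<lambda>y. if y = b then if b \<in> Y then m b \<oplus>\<^bsub>M\<^esub> w else w else m y"
  have "F + frag_of (b, w) \<doteq> (\<Sum>y\<in>Y. frag_of (y, m y)) + frag_of (b, w)"
    using Y by (intro teq_add) auto
  also have "\<dots> \<doteq> (\<Sum>y\<in>insert b Y. frag_of (y, ?m y))"
  proof (cases "b \<in> Y")
    case True
    have "(\<Sum>y\<in>Y. frag_of (y, ?m y)) = frag_of (b, m b \<oplus>\<^bsub>M\<^esub> w) + (\<Sum>y\<in>Y - {b}. frag_of (y, m y))"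
      using True Y(1) by (simp add: sum.remove[OF Y(1) True])
    also have "\<dots> \<doteq> (frag_of (b, m b) + frag_of (b, w)) + (\<Sum>y\<in>Y - {b}. frag_of (y, m y))"
      using True Y assms by (intro teq_add teq_add_right) auto
    also have "\<dots> = (\<Sum>y\<in>Y. frag_of (y, m y)) + frag_of (b, w)"
      by (simp add: sum.remove[OF Y(1) True] algebra_simps)
    finally show ?thesis
      using True by (simp add: insert_absorb teq_sym)
  next
    case False
    have "(\<Sum>y\<in>Y. frag_of (y, ?m y)) = (\<Sum>y\<in>Y. frag_of (y, m y))"
      using False by (intro sum.cong) auto
    then have "(\<Sum>y\<in>insert b Y. frag_of (y, ?m y)) = (\<Sum>y\<in>Y. frag_of (y, m y)) + frag_of (b, w)"
      using False Y(1) by (simp add: add.commute)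
    then show ?thesis by simp
  qed
  finally have "F + frag_of (b, w) \<doteq> (\<Sum>y\<in>insert b Y. frag_of (y, ?m y))" .
  moreover have "?m \<in> insert b Y \<rightarrow> carrier M"
    using Y assms by (auto simp: Pi_iff)
  ultimately show ?thesis
    unfolding tspan_def using Y assms by blast
qed

lemma tspan_add:
  assumes "B \<subseteq> carrier L" "F \<in> tspan B" "G \<in> tspan B"
  shows "F + G \<in> tspan B"
proof -
  obtain Y m where Y: "finite Y" "Y \<subseteq> B" "m \<in> Y \<rightarrow> carrier M" "G \<doteq> (\<Sum>y\<in>Y. frag_of (y, m y))"
    using assms(3) unfolding tspan_def by blast
  have "F + (\<Sum>y\<in>Y. frag_of (y, m y)) \<in> tspan B"
    using Y(1-3)
  proof (induction Y rule: finite_induct)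
    case (insert b Y)
    then show ?case
      using tspan_add_frag_of[OF assms(1), of "F + (\<Sum>y\<in>Y. frag_of (y, m y))" b "m b"]
      by (simp add: ac_simps)
  qed (simp add: assms)
  then show ?thesis
    using teq_add[OF teq_refl teq_sym[OF Y(4)]] tspan_teq by blast
qed

lemma tspan_uminus:
  assumes "B \<subseteq> carrier L" "F \<in> tspan B"
  shows "- F \<in> tspan B"
proof -
  obtain Y m where Y: "finite Y" "Y \<subseteq> B" "m \<in> Y \<rightarrow> carrier M" "F \<doteq> (\<Sum>y\<in>Y. frag_of (y, m y))"
    using assms(2) unfolding tspan_def by blast
  have "- F \<doteq> (\<Sum>y\<in>Y. - frag_of (y, m y))"
    using teq_uminus[OF Y(4)] by (simp add: sum_negf)
  also have "\<dots> \<doteq> (\<Sum>y\<in>Y. frag_of (y, \<ominus>\<^bsub>M\<^esub> m y))"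
    using Y assms by (intro teq_sum teq_sym[OF teq_minus_right]) auto
  finally show ?thesis
    unfolding tspan_def using Y by (auto intro!: exI[of _ Y] exI[of _ "\<lambda>y. \<ominus>\<^bsub>M\<^esub> m y"])
qed

text \<open>The induction rule for free abelian groups builds elements by differences, which
  explains the appeal to \<open>tspan_uminus\<close>.\<close>

lemma tspan_carrier:
  assumes "Poly_Mapping.keys F \<subseteq> carrier L \<times> carrier M"
  shows "F \<in> tspan (carrier L)"
  using assms
proof (rule free_Abelian_group_induct)
  show "0 \<in> tspan (carrier L)"
    by (rule tspan_zero)
  show "F - G \<in> tspan (carrier L)" if "F \<in> tspan (carrier L)" "G \<in> tspan (carrier L)" for F G
    using tspan_add[OF subset_refl that(1) tspan_uminus[OF subset_refl that(2)]] by simp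
  show "frag_of a \<in> tspan (carrier L)" if "a \<in> carrier L \<times> carrier M" for a
    using tspan_add_frag_of[OF subset_refl tspan_zero, of "fst a" "snd a"] that by auto
qed

lemma smult_module_hom: "a \<in> carrier R \<Longrightarrow> (\<lambda>m. a \<odot>\<^bsub>M\<^esub> m) \<in> module_hom R M M"
  by (auto simp: module_hom_def M.smult_r_distr intro!: M.smult_left_commute)

end

text \<open>Isolates the consequence of flatness used from here on, without the type of test
  modules. Locale assumptions are monomorphic, so the index type is fixed to that of
  \<open>L\<close>: families are indexed by elements of \<open>L\<close>, and \<open>x\<close> may
  differ from the identity.\<close>

locale flat_tensor = tensor R L M
  for R :: "('r, 'x) ring_scheme" and L :: "('r, 'l, 'y) module_scheme"
    and M :: "('r, 'm, 'z) module_scheme" +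
  assumes syzygies: "\<lbrakk>finite I; x \<in> I \<rightarrow> carrier L; m \<in> I \<rightarrow> carrier M;
      (\<Sum>i\<in>I. frag_of (x i, m i)) \<in> tensor_null R L M\<rbrakk>
    \<Longrightarrow> \<exists>u\<in>syzygy_span R L M (x :: 'l \<Rightarrow> 'l) I. \<forall>i\<in>I. u i = m i"
begin

text \<open>Annihilation by finitely many scalars commutes with flat tensoring. One scalar
  \<open>a\<close> is added at a time: if a F = 0, flatness writes the coefficients of
  \<open>F\<close> through syzygies d of the elements a y. Each z = sum of d(y) y is then killed by
  \<open>a\<close>, and y \<otimes> d(y) w summed over y is z \<otimes> w.\<close>

lemma annihilated_tspan:
  assumes "finite A" "A \<subseteq> carrier R" "Poly_Mapping.keys F \<subseteq> carrier L \<times> carrier M"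
    and "\<forall>a\<in>A. frag_map2 id (\<lambda>m. a \<odot>\<^bsub>M\<^esub> m) F \<in> tensor_null R L M"
  shows "F \<in> tspan {x \<in> carrier L. \<forall>a\<in>A. a \<odot>\<^bsub>L\<^esub> x = \<zero>\<^bsub>L\<^esub>}"
  using assms
proof (induction A rule: finite_induct)
  case empty
  then show ?case using tspan_carrier by simp
next
  case (insert a A)
  let ?B = "\<lambda>A. {x \<in> carrier L. \<forall>a\<in>A. a \<odot>\<^bsub>L\<^esub> x = \<zero>\<^bsub>L\<^esub>}"
  have a: "a \<in> carrier R" "A \<subseteq> carrier R"
    using insert by auto
  have "F \<in> tspan (?B A)"
    using insert by blast
  then obtain Y m where Y: "finite Y" "Y \<subseteq> ?B A" "m \<in> Y \<rightarrow> carrier M" "F \<doteq> (\<Sum>y\<in>Y. frag_of (y, m y))"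
    unfolding tspan_def by blast
  have YL: "Y \<subseteq> carrier L"
    using Y(2) by blast
  have "frag_map2 id (\<lambda>m. a \<odot>\<^bsub>M\<^esub> m) F \<doteq> frag_map2 id (\<lambda>m. a \<odot>\<^bsub>M\<^esub> m) (\<Sum>y\<in>Y. frag_of (y, m y))"
    using frag_map2_null[OF tensor_axioms tensor_axioms L.id_module_hom smult_module_hom[OF a(1)]] Y(4)
    by (simp add: teq_def flip: frag_extend_diff)
  also have "\<dots> = (\<Sum>y\<in>Y. frag_of (y, a \<odot>\<^bsub>M\<^esub> m y))"
    using Y(1) by (simp add: frag_extend_sum comp_def)
  also have "\<dots> \<doteq> (\<Sum>y\<in>Y. frag_of (a \<odot>\<^bsub>L\<^esub> y, m y))"
    using Y YL a by (intro teq_sum teq_sym[OF teq_smult]) auto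
  finally have "(\<Sum>y\<in>Y. frag_of (a \<odot>\<^bsub>L\<^esub> y, m y)) \<in> tensor_null R L M"
    using teq_null_iff insert by blast
  then obtain u where u: "u \<in> syzygy_span R L M (\<lambda>y. a \<odot>\<^bsub>L\<^esub> y) Y" "\<forall>y\<in>Y. u y = m y"
    using syzygies[of Y "\<lambda>y. a \<odot>\<^bsub>L\<^esub> y" m] Y YL a by blast
  from u(1) have "(\<Sum>y\<in>Y. frag_of (y, u y)) \<in> tspan (?B (insert a A))"
  proof (induction rule: syzygy_span.induct)
    case zero
    have "0 \<doteq> (\<Sum>y\<in>Y. frag_of (y, \<zero>\<^bsub>M\<^esub>))"
      using teq_sum[of Y "\<lambda>_. 0" "\<lambda>y. frag_of (y, \<zero>\<^bsub>M\<^esub>)"] YL teq_sym[OF teq_zero_right] by force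
    then show ?case
      using tspan_zero tspan_teq by blast
  next
    case (step u d w)
    let ?z = "lincomb L id Y d"
    have z: "?z \<in> carrier L"
      using Y YL step(2) by (intro L.lincomb_closed) auto
    have smult: "b \<odot>\<^bsub>L\<^esub> ?z = lincomb L (\<lambda>y. b \<odot>\<^bsub>L\<^esub> id y) Y d" if "b \<in> carrier R" for b
      using Y YL step(2) that by (intro L.lincomb_smult_family[symmetric]) auto
    have "?z \<in> ?B (insert a A)"
    proof -
      have "b \<odot>\<^bsub>L\<^esub> ?z = \<zero>\<^bsub>L\<^esub>" if "b \<in> A" for b
      proof -
        \<comment> \<open>The earlier scalars kill every \<open>y\<close> in \<open>Y\<close>, hence
          every combination of them.\<close>
        have "(\<lambda>y. b \<odot>\<^bsub>L\<^esub> id y) \<in> Y \<rightarrow> {\<zero>\<^bsub>L\<^esub>}"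
          using that Y(2) by auto
        then show ?thesis
          using smult[of b] that a(2) step(2) L.lincomb_eq_zero by (simp add: subset_iff)
      qed
      moreover have "a \<odot>\<^bsub>L\<^esub> ?z = \<zero>\<^bsub>L\<^esub>"
        using smult[OF a(1)] step(3) by simp
      ultimately show ?thesis using z by blast
    qed
    then have "(\<Sum>y\<in>Y. frag_of (y, u y)) + frag_of (?z, w) \<in> tspan (?B (insert a A))"
      using step by (intro tspan_add_frag_of) auto
    moreover have "(\<Sum>y\<in>Y. frag_of (y, u y \<oplus>\<^bsub>M\<^esub> d y \<odot>\<^bsub>M\<^esub> w)) \<doteq> (\<Sum>y\<in>Y. frag_of (y, u y)) + frag_of (?z, w)"
    proof -
      have "(\<Sum>y\<in>Y. frag_of (y, u y \<oplus>\<^bsub>M\<^esub> d y \<odot>\<^bsub>M\<^esub> w))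
          \<doteq> (\<Sum>y\<in>Y. frag_of (y, u y)) + (\<Sum>y\<in>Y. frag_of (y, d y \<odot>\<^bsub>M\<^esub> w))"
        using YL syzygy_span_closed[OF step(1)] step by (intro teq_sum_add_right) auto
      also have "\<dots> \<doteq> (\<Sum>y\<in>Y. frag_of (y, u y)) + frag_of (?z, w)"
        using Y YL step by (intro teq_add teq_lincomb) auto
      finally show ?thesis .
    qed
    ultimately show ?case
      using teq_sym tspan_teq by blast
  qed
  moreover have "(\<Sum>y\<in>Y. frag_of (y, u y)) = (\<Sum>y\<in>Y. frag_of (y, m y))"
    using u(2) by simp
  ultimately show ?case
    using tspan_teq[OF _ teq_sym[OF Y(4)]] by simp
qed

end

section \<open>Strong Krull primes of a tensor product\<close>

lemma restrict_scalars_simps [simp]: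
  "carrier (restrict_scalars \<phi> M) = carrier M"
  "zero (restrict_scalars \<phi> M) = zero M"
  "add (restrict_scalars \<phi> M) = add M"
  "smult (restrict_scalars \<phi> M) r m = \<phi> r \<odot>\<^bsub>M\<^esub> m"
  by (simp_all add: restrict_scalars_def)

locale flat_base_change = flat_tensor R L "restrict_scalars \<phi> M" + S: module S M
  for R :: "('r, 'x) ring_scheme" and L :: "('r, 'l, 'y) module_scheme" and \<phi> :: "'r \<Rightarrow> 's"
    and S :: "('s, 'w) ring_scheme" and M :: "('s, 'm, 'z) module_scheme" +
  assumes hom: "\<phi> \<in> ring_hom R S"
begin

notation teq (infix "\<doteq>" 50)

abbreviation null :: "('l \<times> 'm \<Rightarrow>\<^sub>0 int) set"
  where "null \<equiv> tensor_null R L (restrict_scalars \<phi> M)"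

lemma hom_closed [simp]: "r \<in> carrier R \<Longrightarrow> \<phi> r \<in> carrier S"
  using ring_hom_closed[OF hom] .

lemma S_smult_module_hom:
  "s \<in> carrier S \<Longrightarrow> (\<lambda>m. s \<odot>\<^bsub>M\<^esub> m) \<in> module_hom R (restrict_scalars \<phi> M) (restrict_scalars \<phi> M)"
  by (auto simp: module_hom_def S.smult_r_distr intro!: S.smult_left_commute)

abbreviation scale :: "'s \<Rightarrow> ('l \<times> 'm \<Rightarrow>\<^sub>0 int) \<Rightarrow> ('l \<times> 'm \<Rightarrow>\<^sub>0 int)"
  where "scale s \<equiv> frag_map2 id (\<lambda>m. s \<odot>\<^bsub>M\<^esub> m)"

lemma scale_null: "s \<in> carrier S \<Longrightarrow> F \<in> null \<Longrightarrow> scale s F \<in> null"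
  by (rule frag_map2_null[OF tensor_axioms tensor_axioms L.id_module_hom S_smult_module_hom])

lemma scale_teq: "s \<in> carrier S \<Longrightarrow> F \<doteq> G \<Longrightarrow> scale s F \<doteq> scale s G"
  using scale_null by (simp add: teq_def flip: frag_extend_diff)

lemma scale_sum: "finite X \<Longrightarrow> scale s (\<Sum>x\<in>X. frag_of (x, m x)) = (\<Sum>x\<in>X. frag_of (x, s \<odot>\<^bsub>M\<^esub> m x))"
  by (simp add: frag_extend_sum comp_def)

lemma sum_smult_null:
  assumes "finite X" "m \<in> X \<rightarrow> carrier M" "s \<in> carrier S" "t \<in> carrier S"
    and "(\<Sum>x\<in>X. frag_of (x, s \<odot>\<^bsub>M\<^esub> m x)) \<in> null"
  shows "(\<Sum>x\<in>X. frag_of (x, (t \<otimes>\<^bsub>S\<^esub> s) \<odot>\<^bsub>M\<^esub> m x)) \<in> null"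
proof -
  have "(\<Sum>x\<in>X. frag_of (x, t \<odot>\<^bsub>M\<^esub> (s \<odot>\<^bsub>M\<^esub> m x))) \<in> null"
    using scale_null[OF assms(4,5)] unfolding scale_sum[OF assms(1)] .
  moreover have "(\<Sum>x\<in>X. frag_of (x, t \<odot>\<^bsub>M\<^esub> (s \<odot>\<^bsub>M\<^esub> m x))) = (\<Sum>x\<in>X. frag_of (x, (t \<otimes>\<^bsub>S\<^esub> s) \<odot>\<^bsub>M\<^esub> m x))"
    using assms by (intro sum.cong) (auto simp: S.smult_assoc1 Pi_iff)
  ultimately show ?thesis by simp
qed

text \<open>Induction on the number of terms of the tensor, with \<open>m\<close> arbitrary because
  clearing a term changes the remaining coefficients. The sandwich between \<open>J\<close> and
  \<open>P\<close> survives each reduction, and primality of \<open>P\<close> is what preserves the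
  upper bound.\<close>

lemma pure_tensor_between:
  assumes P: "primeideal P S" and J: "J \<subseteq> carrier S"
    and "finite X" "X \<subseteq> {x \<in> carrier L. \<forall>r\<in>spec_map R \<phi> P. r \<odot>\<^bsub>L\<^esub> x = \<zero>\<^bsub>L\<^esub>}" "m \<in> X \<rightarrow> carrier M"
    and "\<forall>s\<in>J. (\<Sum>x\<in>X. frag_of (x, s \<odot>\<^bsub>M\<^esub> m x)) \<in> null"
    and "\<forall>s\<in>carrier S. (\<Sum>x\<in>X. frag_of (x, s \<odot>\<^bsub>M\<^esub> m x)) \<in> null \<longrightarrow> s \<in> P"
  shows "\<exists>y\<in>carrier L. \<exists>w\<in>carrier M. ann R L y = spec_map R \<phi> P \<and>
    (\<forall>s\<in>J. frag_of (y, s \<odot>\<^bsub>M\<^esub> w) \<in> null) \<and> (\<forall>s\<in>carrier S. frag_of (y, s \<odot>\<^bsub>M\<^esub> w) \<in> null \<longrightarrow> s \<in> P)"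
  using assms(3-)
proof (induction X arbitrary: m rule: finite_induct)
  case empty
  \<comment> \<open>The zero tensor is killed by 1, which cannot lie in a prime ideal.\<close>
  then have "\<one>\<^bsub>S\<^esub> \<in> P" by simp
  then show ?case
    using P by (metis ideal.one_imp_carrier primeideal.I_notcarr primeideal.axioms(1))
next
  case (insert y X)
  let ?q = "spec_map R \<phi> P" and ?MR = "restrict_scalars \<phi> M"
  interpret P: primeideal P S by (rule P)
  have X: "X \<subseteq> {x \<in> carrier L. \<forall>r\<in>?q. r \<odot>\<^bsub>L\<^esub> x = \<zero>\<^bsub>L\<^esub>}" "X \<subseteq> carrier L" "m \<in> X \<rightarrow> carrier M"
    using insert.prems by auto
  have y: "y \<in> carrier L" "m y \<in> carrier M"
    using insert.prems by auto
  show ?case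
  proof (cases "\<exists>r\<in>carrier R - ?q. \<exists>c\<in>UNIV \<rightarrow> carrier R. r \<odot>\<^bsub>L\<^esub> y = lincomb L id X c")
    case True
    then obtain r c where r: "r \<in> carrier R" "r \<notin> ?q" and c: "c \<in> UNIV \<rightarrow> carrier R"
      and rc: "r \<odot>\<^bsub>L\<^esub> y = lincomb L id X c" by blast
    \<comment> \<open>Substituting r y = sum of c(x) x into r times the tensor eliminates
      \<open>y\<close>; these are the resulting coefficients.\<close>
    define m' where "m' = (\<lambda>x. \<phi> r \<odot>\<^bsub>M\<^esub> m x \<oplus>\<^bsub>M\<^esub> \<phi> (c x) \<odot>\<^bsub>M\<^esub> m y)"
    have m': "m' \<in> X \<rightarrow> carrier M"
      unfolding m'_def using X r c y by (auto simp: Pi_iff)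
    have teq: "(\<Sum>x\<in>X. frag_of (x, s \<odot>\<^bsub>M\<^esub> m' x)) \<doteq> (\<Sum>x\<in>insert y X. frag_of (x, (s \<otimes>\<^bsub>S\<^esub> \<phi> r) \<odot>\<^bsub>M\<^esub> m x))"
      if s: "s \<in> carrier S" for s
    proof -
      have "(\<Sum>x\<in>X. frag_of (x, s \<odot>\<^bsub>M\<^esub> m' x))
          = (\<Sum>x\<in>X. frag_of (x, (s \<otimes>\<^bsub>S\<^esub> \<phi> r) \<odot>\<^bsub>M\<^esub> m x \<oplus>\<^bsub>?MR\<^esub> c x \<odot>\<^bsub>?MR\<^esub> (s \<odot>\<^bsub>M\<^esub> m y)))"
      proof (intro sum.cong refl arg_cong[of _ _ frag_of] prod_eqI)
        fix x assume "x \<in> X"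
        then have "m x \<in> carrier M" "\<phi> (c x) \<in> carrier S"
          using X c by (auto simp: Pi_iff)
        then show "snd (x, s \<odot>\<^bsub>M\<^esub> m' x) = snd (x, (s \<otimes>\<^bsub>S\<^esub> \<phi> r) \<odot>\<^bsub>M\<^esub> m x \<oplus>\<^bsub>?MR\<^esub> c x \<odot>\<^bsub>?MR\<^esub> (s \<odot>\<^bsub>M\<^esub> m y))"
          using s r y
          by (simp add: m'_def S.smult_r_distr S.smult_assoc1 S.smult_left_commute[of s "\<phi> (c x)"])
      qed simp
      also have "\<dots> \<doteq> (\<Sum>x\<in>X. frag_of (x, (s \<otimes>\<^bsub>S\<^esub> \<phi> r) \<odot>\<^bsub>M\<^esub> m x)) + (\<Sum>x\<in>X. frag_of (x, c x \<odot>\<^bsub>?MR\<^esub> (s \<odot>\<^bsub>M\<^esub> m y)))"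
        using X s r c y by (intro teq_sum_add_right) (auto simp: Pi_iff)
      also have "\<dots> \<doteq> (\<Sum>x\<in>X. frag_of (x, (s \<otimes>\<^bsub>S\<^esub> \<phi> r) \<odot>\<^bsub>M\<^esub> m x)) + frag_of (lincomb L id X c, s \<odot>\<^bsub>M\<^esub> m y)"
        using X s c y insert.hyps by (intro teq_add teq_lincomb teq_refl) auto
      also have "\<dots> \<doteq> (\<Sum>x\<in>X. frag_of (x, (s \<otimes>\<^bsub>S\<^esub> \<phi> r) \<odot>\<^bsub>M\<^esub> m x)) + frag_of (y, r \<odot>\<^bsub>?MR\<^esub> (s \<odot>\<^bsub>M\<^esub> m y))"
        unfolding rc[symmetric] using s r y by (intro teq_add teq_smult teq_refl) auto
      also have "r \<odot>\<^bsub>?MR\<^esub> (s \<odot>\<^bsub>M\<^esub> m y) = (s \<otimes>\<^bsub>S\<^esub> \<phi> r) \<odot>\<^bsub>M\<^esub> m y"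
        using s r y by (simp add: S.smult_assoc1 S.smult_left_commute[of s "\<phi> r"])
      also have "(\<Sum>x\<in>X. frag_of (x, (s \<otimes>\<^bsub>S\<^esub> \<phi> r) \<odot>\<^bsub>M\<^esub> m x)) + frag_of (y, (s \<otimes>\<^bsub>S\<^esub> \<phi> r) \<odot>\<^bsub>M\<^esub> m y)
          = (\<Sum>x\<in>insert y X. frag_of (x, (s \<otimes>\<^bsub>S\<^esub> \<phi> r) \<odot>\<^bsub>M\<^esub> m x))"
        using insert.hyps by (simp add: add.commute)
      finally show ?thesis .
    qed
    show ?thesis
    proof (rule insert.IH[OF X(1) m'])
      show "\<forall>s\<in>J. (\<Sum>x\<in>X. frag_of (x, s \<odot>\<^bsub>M\<^esub> m' x)) \<in> null"
      proof
        fix s assume "s \<in> J"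
        then have s: "s \<in> carrier S" and "(\<Sum>x\<in>insert y X. frag_of (x, s \<odot>\<^bsub>M\<^esub> m x)) \<in> null"
          using J insert.prems(3) by auto
        then have "(\<Sum>x\<in>insert y X. frag_of (x, (\<phi> r \<otimes>\<^bsub>S\<^esub> s) \<odot>\<^bsub>M\<^esub> m x)) \<in> null"
          using insert.hyps insert.prems(2) r by (intro sum_smult_null) auto
        then show "(\<Sum>x\<in>X. frag_of (x, s \<odot>\<^bsub>M\<^esub> m' x)) \<in> null"
          using teq_null_iff[OF teq[OF s]] s r by (simp add: S.m_comm)
      qed
      show "\<forall>s\<in>carrier S. (\<Sum>x\<in>X. frag_of (x, s \<odot>\<^bsub>M\<^esub> m' x)) \<in> null \<longrightarrow> s \<in> P"
      proof (intro ballI impI)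
        fix s assume s: "s \<in> carrier S" and "(\<Sum>x\<in>X. frag_of (x, s \<odot>\<^bsub>M\<^esub> m' x)) \<in> null"
        \<comment> \<open>If s kills r z, then s r kills z and lies in \<open>P\<close>; since r is
          outside the preimage of \<open>P\<close>, s lies in \<open>P\<close>.\<close>
        then have "s \<otimes>\<^bsub>S\<^esub> \<phi> r \<in> P"
          using teq_null_iff[OF teq[OF s]] insert.prems(4) r by simp
        moreover have "\<phi> r \<notin> P"
          using r by (simp add: spec_map_def)
        ultimately show "s \<in> P"
          using P.I_prime[OF s hom_closed[OF r(1)]] by blast
      qed
    qed
  next
    case False
    have ann_y: "ann R L y = ?q"
    proof -
      have "r \<in> ?q" if "r \<in> carrier R" "r \<odot>\<^bsub>L\<^esub> y = \<zero>\<^bsub>L\<^esub>" for r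
      proof -
        have "id \<in> X \<rightarrow> carrier L"
          using X(2) by auto
        \<comment> \<open>A scalar killing \<open>y\<close> moves \<open>y\<close> to the zero
          combination of \<open>X\<close>, so the failed case assumption forces it into
          \<open>?q\<close>.\<close>
        then have "lincomb L id X (\<lambda>_. \<zero>\<^bsub>R\<^esub>) = \<zero>\<^bsub>L\<^esub>"
          by (rule L.lincomb_zero[OF insert.hyps(1)])
        then have "\<exists>c\<in>UNIV \<rightarrow> carrier R. r \<odot>\<^bsub>L\<^esub> y = lincomb L id X c"
          using that by (intro bexI[of _ "\<lambda>_. \<zero>\<^bsub>R\<^esub>"]) simp_all
        then show ?thesis
          using False that by blast
      qed
      moreover have "r \<odot>\<^bsub>L\<^esub> y = \<zero>\<^bsub>L\<^esub>" if "r \<in> ?q" for r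
        using insert.prems(1) that by blast
      ultimately show ?thesis
        by (auto simp: ann_def spec_map_def)
    qed
    have split: "(\<Sum>x\<in>insert y X. frag_of (x, s \<odot>\<^bsub>M\<^esub> m x)) =
        frag_of (y, s \<odot>\<^bsub>M\<^esub> m y) + (\<Sum>x\<in>X. frag_of (x, s \<odot>\<^bsub>M\<^esub> m x))" for s
      using insert.hyps by simp
    \<comment> \<open>The term of \<open>y\<close> splits off: in any syzygy of
      \<open>insert y X\<close> the coefficient of \<open>y\<close> moves \<open>y\<close> into the
      span of \<open>X\<close>, hence lies in \<open>?q\<close> and kills \<open>y\<close>. So each
      syzygy contributes zero to the \<open>y\<close> term.\<close>
    have y_null: "frag_of (y, s \<odot>\<^bsub>M\<^esub> m y) \<in> null"
      if s: "s \<in> carrier S" and null: "(\<Sum>x\<in>insert y X. frag_of (x, s \<odot>\<^bsub>M\<^esub> m x)) \<in> null" for s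
    proof -
      have "(\<lambda>x. s \<odot>\<^bsub>M\<^esub> m x) \<in> insert y X \<rightarrow> carrier (restrict_scalars \<phi> M)"
        using s X y by auto
      moreover have "id \<in> insert y X \<rightarrow> carrier L"
        using X y by auto
      ultimately obtain u where u: "u \<in> syzygy_span R L ?MR id (insert y X)"
          "\<forall>x\<in>insert y X. u x = s \<odot>\<^bsub>M\<^esub> m x"
        using syzygies[of "insert y X" id "\<lambda>x. s \<odot>\<^bsub>M\<^esub> m x"] insert.hyps null by auto
      from u(1) have "frag_of (y, u y) \<in> null"
      proof (induction rule: syzygy_span.induct)
        case zero
        then show ?case
          using teq_zero_right[OF y(1)] by (simp add: teq_zero_iff)
      next
        case (step u d w)
        let ?c = "lincomb L id X d"
        have c: "?c \<in> carrier L"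
          using insert.hyps X step(2) by (intro L.lincomb_closed) auto
        have dy: "d y \<in> carrier R"
          using step(2) by auto
        have "d y \<odot>\<^bsub>L\<^esub> y \<oplus>\<^bsub>L\<^esub> ?c = \<zero>\<^bsub>L\<^esub>"
          using L.lincomb_insert[of X y d] insert.hyps X y step by simp
        then have "d y \<odot>\<^bsub>L\<^esub> y = \<ominus>\<^bsub>L\<^esub> ?c"
          using c dy y by (metis L.M.minus_equality L.smult_closed)
        also have "\<dots> = lincomb L id X (\<lambda>x. \<ominus>\<^bsub>R\<^esub> d x)"
          using insert.hyps X step(2) by (intro L.lincomb_uminus[symmetric]) auto
        finally have "d y \<odot>\<^bsub>L\<^esub> y = lincomb L id X (\<lambda>x. \<ominus>\<^bsub>R\<^esub> d x)" .
        moreover have "(\<lambda>x. \<ominus>\<^bsub>R\<^esub> d x) \<in> UNIV \<rightarrow> carrier R"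
          using step(2) by auto
        ultimately have "d y \<in> ?q"
          using False dy by blast
        then have "d y \<odot>\<^bsub>L\<^esub> y = \<zero>\<^bsub>L\<^esub>"
          using ann_y by (auto simp: ann_def)
        then have "frag_of (y, d y \<odot>\<^bsub>?MR\<^esub> w) \<doteq> 0"
          using teq_trans[OF teq_sym[OF teq_smult[OF dy y(1) step(4)]]] teq_zero_left[OF step(4)] by simp
        moreover have "frag_of (y, u y \<oplus>\<^bsub>?MR\<^esub> d y \<odot>\<^bsub>?MR\<^esub> w) \<doteq> frag_of (y, u y) + frag_of (y, d y \<odot>\<^bsub>?MR\<^esub> w)"
          using y dy step(4) syzygy_span_closed[OF step(1)] by (intro teq_add_right) auto
        ultimately show ?case
          using step(5) teq_null_iff tensor_null_add teq_zero_iff by blast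
      qed
      then show ?thesis using u(2) by simp
    qed
    show ?thesis
    proof (cases "\<forall>s\<in>carrier S. frag_of (y, s \<odot>\<^bsub>M\<^esub> m y) \<in> null \<longrightarrow> s \<in> P")
      case True
      then show ?thesis
        using ann_y y y_null insert.prems(3) J by (intro bexI[of _ y] bexI[of _ "m y"] conjI) auto
    next
      case False
      \<comment> \<open>\<open>t\<close> witnesses that the annihilator of the \<open>y\<close> term
        is not inside \<open>P\<close>. If s kills the other terms, then s t kills the whole tensor,
        so s t is in \<open>P\<close> and therefore s is.\<close>
      then obtain t where t: "t \<in> carrier S" "frag_of (y, t \<odot>\<^bsub>M\<^esub> m y) \<in> null" "t \<notin> P"
        by blast
      show ?thesis
      proof (rule insert.IH[OF X(1,3)])
        show "\<forall>s\<in>J. (\<Sum>x\<in>X. frag_of (x, s \<odot>\<^bsub>M\<^esub> m x)) \<in> null"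
        proof
          fix s assume "s \<in> J"
          then have "s \<in> carrier S" "(\<Sum>x\<in>insert y X. frag_of (x, s \<odot>\<^bsub>M\<^esub> m x)) \<in> null"
            using J insert.prems(3) by auto
          from tensor_null_diff[OF this(2) y_null[OF this]]
          show "(\<Sum>x\<in>X. frag_of (x, s \<odot>\<^bsub>M\<^esub> m x)) \<in> null"
            by (simp add: split)
        qed
        show "\<forall>s\<in>carrier S. (\<Sum>x\<in>X. frag_of (x, s \<odot>\<^bsub>M\<^esub> m x)) \<in> null \<longrightarrow> s \<in> P"
        proof (intro ballI impI)
          fix s assume s: "s \<in> carrier S" and "(\<Sum>x\<in>X. frag_of (x, s \<odot>\<^bsub>M\<^esub> m x)) \<in> null"
          then have "(\<Sum>x\<in>X. frag_of (x, (t \<otimes>\<^bsub>S\<^esub> s) \<odot>\<^bsub>M\<^esub> m x)) \<in> null"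
            using t X insert.hyps by (intro sum_smult_null) auto
          moreover have "frag_of (y, (s \<otimes>\<^bsub>S\<^esub> t) \<odot>\<^bsub>M\<^esub> m y) \<in> null"
            using sum_smult_null[of "{y}" m t s] s t y by simp
          ultimately have "(\<Sum>x\<in>insert y X. frag_of (x, (s \<otimes>\<^bsub>S\<^esub> t) \<odot>\<^bsub>M\<^esub> m x)) \<in> null"
            using s t by (simp add: split tensor_null_add S.m_comm)
          then have "s \<otimes>\<^bsub>S\<^esub> t \<in> P"
            using insert.prems(4) s t by simp
          then show "s \<in> P"
            using P.I_prime s t by blast
        qed
      qed
    qed
  qed
qed

text \<open>The syzygies of the one-element family \<open>y\<close> are the elements of its
  annihilator, so flatness writes \<open>w\<close> as a sum of products a m with a y = 0. Conversely
  such an a can be moved to the left factor, where it kills \<open>y\<close>.\<close>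

lemma null_frag_of_iff:
  assumes y: "y \<in> carrier L" and w: "w \<in> carrier M"
  shows "frag_of (y, w) \<in> null \<longleftrightarrow> w \<in> ideal_times (ann R L y) (restrict_scalars \<phi> M)"
proof
  let ?K = "ideal_times (ann R L y) (restrict_scalars \<phi> M)" and ?MR = "restrict_scalars \<phi> M"
  assume "frag_of (y, w) \<in> null"
  then obtain u where u: "u \<in> syzygy_span R L ?MR id {y}" "u y = w"
    using syzygies[of "{y}" id "\<lambda>_. w"] y w by auto
  from u(1) have "u y \<in> ?K"
  proof (induction rule: syzygy_span.induct)
    case zero
    then show ?case
      using generate.one[of "add_monoid ?MR"] by (simp add: ideal_times_def)
  next
    case (step u d w)
    then have "d y \<in> carrier R"
      by auto
    then have "d y \<in> ann R L y"
      using step(3) y by (simp add: lincomb_def ann_def)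
    then have "d y \<odot>\<^bsub>?MR\<^esub> w \<in> ?K"
      unfolding ideal_times_def using step(4) by (intro generate.incl) blast
    then show ?case
      using step(5) generate.eng[of "u y" "add_monoid ?MR"] by (simp add: ideal_times_def)
  qed
  then show "w \<in> ?K"
    using u(2) by simp
next
  let ?MR = "restrict_scalars \<phi> M"
  have pure: "h \<in> carrier M \<and> frag_of (y, h) \<in> null"
    if "h \<in> {a \<odot>\<^bsub>?MR\<^esub> m |a m. a \<in> ann R L y \<and> m \<in> carrier ?MR}" for h
  proof -
    from that obtain a m where a: "a \<in> carrier R" "a \<odot>\<^bsub>L\<^esub> y = \<zero>\<^bsub>L\<^esub>" and m: "m \<in> carrier ?MR"
      and h: "h = a \<odot>\<^bsub>?MR\<^esub> m" by (auto simp: ann_def)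
    have "frag_of (y, h) \<doteq> 0"
      using teq_trans[OF teq_sym[OF teq_smult[OF a(1) y m]]] teq_zero_left[OF m] a(2) h by simp
    then show ?thesis
      using teq_zero_iff M.smult_closed[OF a(1) m] h by simp
  qed
  assume "w \<in> ideal_times (ann R L y) ?MR"
  then have "w \<in> carrier M \<and> frag_of (y, w) \<in> null"
    unfolding ideal_times_def
  proof (induction rule: generate.induct)
    case one
    then show ?case
      using teq_zero_right[OF y] by (simp add: teq_zero_iff)
  next
    case (incl h)
    then show ?case by (rule pure)
  next
    case (inv h)
    then have h: "h \<in> carrier ?MR" "frag_of (y, h) \<in> null"
      using pure[OF inv] by auto
    have "inv\<^bsub>add_monoid ?MR\<^esub> h = \<ominus>\<^bsub>?MR\<^esub> h"
      by (simp add: a_inv_def)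
    then show ?case
      using M.M.a_inv_closed[OF h(1)] teq_null_iff[OF teq_minus_right[OF y h(1)]]
        tensor_null_uminus[OF h(2)]
      by simp
  next
    case (eng h h')
    then show ?case
      using teq_null_iff[OF teq_add_right[OF y, of h h']] tensor_null_add by simp
  qed
  then show "frag_of (y, w) \<in> null" ..
qed

section \<open>Strong Krull primes in terms of formal sums\<close>

lemma keys_scale:
  assumes "s \<in> carrier S" "Poly_Mapping.keys F \<subseteq> carrier L \<times> carrier M"
  shows "Poly_Mapping.keys (scale s F) \<subseteq> carrier L \<times> carrier M"
proof (intro order_trans[OF keys_frag_extend] UN_least)
  fix z assume "z \<in> Poly_Mapping.keys F"
  then obtain x m where "z = (x, m)" "x \<in> carrier L" "m \<in> carrier M"
    using assms(2) by auto
  then show "Poly_Mapping.keys (case z of (x, m) \<Rightarrow> frag_of (id x, s \<odot>\<^bsub>M\<^esub> m)) \<subseteq> carrier L \<times> carrier M"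
    using assms(1) by simp
qed

text \<open>Cosets are eliminated once and for all: \<open>scale\<close> computes the S-action on
  representatives, so annihilators are read off from the null subgroup.\<close>

lemma sK_tensor_module_iff:
  "P \<in> sK S (tensor_module R \<phi> L M) \<longleftrightarrow> P \<in> Spec S \<and>
    (\<forall>I. fin_gen_ideal I S \<and> I \<subseteq> P \<longrightarrow>
      (\<exists>F. Poly_Mapping.keys F \<subseteq> carrier L \<times> carrier M \<and>
        I \<subseteq> {s \<in> carrier S. scale s F \<in> null} \<and> {s \<in> carrier S. scale s F \<in> null} \<subseteq> P))"
proof -
  let ?LM = "tensor_module R \<phi> L M" and ?Fr = "tensor_free L (restrict_scalars \<phi> M)"
  have carrier: "carrier ?LM = {null #>\<^bsub>?Fr\<^esub> F |F. Poly_Mapping.keys F \<subseteq> carrier L \<times> carrier M}"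
    by (auto simp: tensor_module_def Let_def tensor_carrier_def RCOSETS_def tensor_free_def)
  have ann: "ann S ?LM (null #>\<^bsub>?Fr\<^esub> F) = {s \<in> carrier S. scale s F \<in> null}"
    if "Poly_Mapping.keys F \<subseteq> carrier L \<times> carrier M" for F
  proof -
    have "s \<odot>\<^bsub>?LM\<^esub> (null #>\<^bsub>?Fr\<^esub> F) = null #>\<^bsub>?Fr\<^esub> scale s F" if "s \<in> carrier S" for s
      using tensor_map_coset[OF tensor_axioms tensor_axioms L.id_module_hom S_smult_module_hom[OF that]]
      by (simp add: tensor_module_def Let_def)
    moreover have "null #>\<^bsub>?Fr\<^esub> scale s F = null \<longleftrightarrow> scale s F \<in> null" if "s \<in> carrier S" for s
      using coset_eq_null_iff[unfolded restrict_scalars_simps, OF keys_scale[OF that \<open>_ \<subseteq> _\<close>]] .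
    moreover have "\<zero>\<^bsub>?LM\<^esub> = null"
      by (simp add: tensor_module_def Let_def)
    ultimately show ?thesis
      unfolding ann_def by auto
  qed
  have "(\<exists>z\<in>carrier ?LM. I \<subseteq> ann S ?LM z \<and> ann S ?LM z \<subseteq> P) \<longleftrightarrow>
      (\<exists>F. Poly_Mapping.keys F \<subseteq> carrier L \<times> carrier M \<and>
        I \<subseteq> {s \<in> carrier S. scale s F \<in> null} \<and> {s \<in> carrier S. scale s F \<in> null} \<subseteq> P)" for I
  proof -
    have "(\<exists>z\<in>carrier ?LM. I \<subseteq> ann S ?LM z \<and> ann S ?LM z \<subseteq> P) \<longleftrightarrow>
        (\<exists>F. Poly_Mapping.keys F \<subseteq> carrier L \<times> carrier M \<and>
          I \<subseteq> ann S ?LM (null #>\<^bsub>?Fr\<^esub> F) \<and> ann S ?LM (null #>\<^bsub>?Fr\<^esub> F) \<subseteq> P)"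
      unfolding carrier by blast
    then show ?thesis by (simp only: ann cong: conj_cong)
  qed
  then show ?thesis
    by (simp only: sK_def mem_Collect_eq)
qed

text \<open>By \<open>null_frag_of_iff\<close>, w \<mapsto> y \<otimes> w induces an embedding of
  the quotient into L \<otimes> M, so the class of \<open>w\<close> and the tensor y \<otimes> w
  have the same annihilator.\<close>

lemma sK_quot_module_iff:
  assumes y: "y \<in> carrier L"
  shows "P \<in> sK S (quot_module M (ideal_times (ann R L y) (restrict_scalars \<phi> M))) \<longleftrightarrow> P \<in> Spec S \<and>
    (\<forall>I. fin_gen_ideal I S \<and> I \<subseteq> P \<longrightarrow>
      (\<exists>w\<in>carrier M. I \<subseteq> {s \<in> carrier S. frag_of (y, s \<odot>\<^bsub>M\<^esub> w) \<in> null} \<and>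
        {s \<in> carrier S. frag_of (y, s \<odot>\<^bsub>M\<^esub> w) \<in> null} \<subseteq> P))"
proof -
  define K where "K = ideal_times (ann R L y) (restrict_scalars \<phi> M)"
  let ?Q = "quot_module M K"
  have carrier: "carrier ?Q = {K +>\<^bsub>M\<^esub> w |w. w \<in> carrier M}"
    by (auto simp: quot_module_def A_RCOSETS_def')
  have sub: "subgroup K (add_monoid (restrict_scalars \<phi> M))"
  proof -
    have "{a \<odot>\<^bsub>restrict_scalars \<phi> M\<^esub> m |a m. a \<in> ann R L y \<and> m \<in> carrier (restrict_scalars \<phi> M)}
        \<subseteq> carrier (restrict_scalars \<phi> M)"
      by (auto simp: ann_def)
    from M.M.add.generate_is_subgroup[OF this] show ?thesis
      unfolding K_def ideal_times_def .
  qed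
  have KM: "K \<subseteq> carrier M" and K_zero: "\<zero>\<^bsub>M\<^esub> \<in> K"
    and K_add: "\<And>h k. h \<in> K \<Longrightarrow> k \<in> K \<Longrightarrow> h \<oplus>\<^bsub>M\<^esub> k \<in> K"
    and K_minus: "\<And>h. h \<in> K \<Longrightarrow> \<ominus>\<^bsub>restrict_scalars \<phi> M\<^esub> h \<in> K"
    using subgroup.subset[OF sub] subgroup.one_closed[OF sub] subgroup.m_closed[OF sub]
      subgroup.m_inv_closed[OF sub] by (simp_all add: a_inv_def)
  \<comment> \<open>\<open>K\<close> is defined through the R-action only; its stability under
    \<open>S\<close> is read off from that of the null subgroup.\<close>
  have K_smult: "s \<odot>\<^bsub>M\<^esub> k \<in> K" if "s \<in> carrier S" "k \<in> K" for s k
    using scale_null[of s "frag_of (y, k)"] that KM null_frag_of_iff[OF y] by (auto simp: K_def)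
  have ann: "ann S ?Q (K +>\<^bsub>M\<^esub> w) = {s \<in> carrier S. frag_of (y, s \<odot>\<^bsub>M\<^esub> w) \<in> null}"
    if w: "w \<in> carrier M" for w
  proof -
    have "s \<odot>\<^bsub>?Q\<^esub> (K +>\<^bsub>M\<^esub> w) = K \<longleftrightarrow> s \<odot>\<^bsub>M\<^esub> w \<in> K" if s: "s \<in> carrier S" for s
    proof -
      have eq: "s \<odot>\<^bsub>?Q\<^esub> (K +>\<^bsub>M\<^esub> w) = {h \<oplus>\<^bsub>M\<^esub> s \<odot>\<^bsub>M\<^esub> (k \<oplus>\<^bsub>M\<^esub> w) |h k. h \<in> K \<and> k \<in> K}"
        by (auto simp: quot_module_def set_add_def' a_r_coset_def')
      show ?thesis
      proof
        assume "s \<odot>\<^bsub>?Q\<^esub> (K +>\<^bsub>M\<^esub> w) = K"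
        then have "\<zero>\<^bsub>M\<^esub> \<oplus>\<^bsub>M\<^esub> s \<odot>\<^bsub>M\<^esub> (\<zero>\<^bsub>M\<^esub> \<oplus>\<^bsub>M\<^esub> w) \<in> K"
          using K_zero unfolding eq by blast
        then show "s \<odot>\<^bsub>M\<^esub> w \<in> K"
          using s w by simp
      next
        assume sw: "s \<odot>\<^bsub>M\<^esub> w \<in> K"
        have "h \<oplus>\<^bsub>M\<^esub> s \<odot>\<^bsub>M\<^esub> (k \<oplus>\<^bsub>M\<^esub> w) \<in> K" if "h \<in> K" "k \<in> K" for h k
        proof -
          have "s \<odot>\<^bsub>M\<^esub> (k \<oplus>\<^bsub>M\<^esub> w) = s \<odot>\<^bsub>M\<^esub> k \<oplus>\<^bsub>M\<^esub> s \<odot>\<^bsub>M\<^esub> w"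
            using that KM s w by (intro S.smult_r_distr) auto
          then show ?thesis
            using K_add K_smult that sw s by simp
        qed
        \<comment> \<open>The scalar multiple of the coset is K + s (K + w). To reach
          \<open>h\<close>, take h - s w in the first copy of \<open>K\<close> and 0 in the
          second.\<close>
        moreover have "\<exists>h' k. h = h' \<oplus>\<^bsub>M\<^esub> s \<odot>\<^bsub>M\<^esub> (k \<oplus>\<^bsub>M\<^esub> w) \<and> h' \<in> K \<and> k \<in> K" if "h \<in> K" for h
        proof (intro exI conjI)
          have "h \<in> carrier M" using that KM by blast
          then show "h = (h \<oplus>\<^bsub>M\<^esub> \<ominus>\<^bsub>restrict_scalars \<phi> M\<^esub> (s \<odot>\<^bsub>M\<^esub> w)) \<oplus>\<^bsub>M\<^esub> s \<odot>\<^bsub>M\<^esub> (\<zero>\<^bsub>M\<^esub> \<oplus>\<^bsub>M\<^esub> w)"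
            using s w M.M.l_neg[of "s \<odot>\<^bsub>M\<^esub> w"] M.M.a_inv_closed[of "s \<odot>\<^bsub>M\<^esub> w"]
            by (simp add: S.M.a_assoc)
        qed (use that sw K_zero K_add K_minus in auto)
        ultimately show "s \<odot>\<^bsub>?Q\<^esub> (K +>\<^bsub>M\<^esub> w) = K"
          unfolding eq by blast
      qed
    qed
    moreover have "s \<odot>\<^bsub>M\<^esub> w \<in> K \<longleftrightarrow> frag_of (y, s \<odot>\<^bsub>M\<^esub> w) \<in> null" if "s \<in> carrier S" for s
      using null_frag_of_iff[OF y] w that by (simp add: K_def)
    moreover have "\<zero>\<^bsub>?Q\<^esub> = K"
      by (simp add: quot_module_def)
    ultimately show ?thesis
      unfolding ann_def by auto
  qed
  have "(\<exists>z\<in>carrier ?Q. I \<subseteq> ann S ?Q z \<and> ann S ?Q z \<subseteq> P) \<longleftrightarrow>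
      (\<exists>w\<in>carrier M. I \<subseteq> {s \<in> carrier S. frag_of (y, s \<odot>\<^bsub>M\<^esub> w) \<in> null} \<and>
        {s \<in> carrier S. frag_of (y, s \<odot>\<^bsub>M\<^esub> w) \<in> null} \<subseteq> P)" for I
  proof -
    have "(\<exists>z\<in>carrier ?Q. I \<subseteq> ann S ?Q z \<and> ann S ?Q z \<subseteq> P) \<longleftrightarrow>
        (\<exists>w\<in>carrier M. I \<subseteq> ann S ?Q (K +>\<^bsub>M\<^esub> w) \<and> ann S ?Q (K +>\<^bsub>M\<^esub> w) \<subseteq> P)"
      unfolding carrier by blast
    then show ?thesis by (simp only: ann cong: bex_cong)
  qed
  then show ?thesis
    by (simp only: K_def[symmetric] sK_def mem_Collect_eq)
qed

lemma sK_tensor_module: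
  assumes "noetherian_ring R"
  shows "sK S (tensor_module R \<phi> L M) =
    (\<Union>\<pp>\<in>Ass R L. sK S (quot_module M (ideal_times \<pp> (restrict_scalars \<phi> M))))"
    (is "?A = ?B")
proof
  show "?B \<subseteq> ?A"
  proof
    fix P assume "P \<in> ?B"
    then obtain y where "y \<in> carrier L"
      and P: "P \<in> sK S (quot_module M (ideal_times (ann R L y) (restrict_scalars \<phi> M)))"
      by (auto simp: Ass_def)
    have "\<exists>F. Poly_Mapping.keys F \<subseteq> carrier L \<times> carrier M \<and>
        I \<subseteq> {s \<in> carrier S. scale s F \<in> null} \<and> {s \<in> carrier S. scale s F \<in> null} \<subseteq> P"
      if I: "fin_gen_ideal I S" "I \<subseteq> P" for I
    proof -
      obtain w where "w \<in> carrier M" "I \<subseteq> {s \<in> carrier S. frag_of (y, s \<odot>\<^bsub>M\<^esub> w) \<in> null}"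
        "{s \<in> carrier S. frag_of (y, s \<odot>\<^bsub>M\<^esub> w) \<in> null} \<subseteq> P"
        using P I unfolding sK_quot_module_iff[OF \<open>y \<in> carrier L\<close>] by blast
      then show ?thesis
        using \<open>y \<in> carrier L\<close> by (intro exI[of _ "frag_of (y, w)"]) simp
    qed
    then show "P \<in> ?A"
      using P unfolding sK_quot_module_iff[OF \<open>y \<in> carrier L\<close>] sK_tensor_module_iff by blast
  qed
next
  show "?A \<subseteq> ?B"
  proof
    fix P assume PA: "P \<in> ?A"
    then have P: "primeideal P S"
      unfolding sK_tensor_module_iff Spec_def by blast
    interpret P: primeideal P S by (rule P)
    let ?q = "spec_map R \<phi> P"
    interpret \<phi>: ring_hom_ring R S \<phi>
      using hom L.R.ring_axioms S.R.ring_axioms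
      by (simp add: ring_hom_ring_def ring_hom_ring_axioms_def)
    have q: "primeideal ?q R"
      using \<phi>.primeideal_vimage[OF L.R.is_cring P] by (simp add: spec_map_def)
    \<comment> \<open>The Noetherian hypothesis enters here: \<open>?q\<close> has a finite
      generating set, so its extension to \<open>S\<close> can be added to a finitely generated
      ideal.\<close>
    then obtain A where A: "A \<subseteq> carrier R" "finite A" "?q = Idl\<^bsub>R\<^esub> A"
      using noetherian_ring.finetely_gen[OF assms primeideal.axioms(1)] by blast
    have Aq: "A \<subseteq> ?q"
      using L.R.genideal_self[OF A(1)] A(3) by simp
    have approx: "\<exists>y\<in>carrier L. \<exists>w\<in>carrier M. ann R L y = ?q \<and>
        I \<subseteq> {s \<in> carrier S. frag_of (y, s \<odot>\<^bsub>M\<^esub> w) \<in> null} \<and>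
        {s \<in> carrier S. frag_of (y, s \<odot>\<^bsub>M\<^esub> w) \<in> null} \<subseteq> P"
      if I: "fin_gen_ideal I S" "I \<subseteq> P" for I
    proof -
      obtain G where G: "G \<subseteq> carrier S" "finite G" "I = Idl\<^bsub>S\<^esub> G"
        using I(1) unfolding fin_gen_ideal_def by blast
      \<comment> \<open>Enlarging \<open>I\<close> by the image of \<open>?q\<close> forces the
        approximating tensor to be killed by \<open>?q\<close> as well, as
        \<open>annihilated_tspan\<close> requires.\<close>
      let ?J = "Idl\<^bsub>S\<^esub> (G \<union> \<phi> ` A)"
      have GA: "G \<union> \<phi> ` A \<subseteq> carrier S"
        using G A by auto
      have GAJ: "G \<union> \<phi> ` A \<subseteq> ?J"
        using S.R.genideal_self[OF GA] .
      have IJ: "I \<subseteq> ?J"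
        unfolding G(3) using GAJ by (intro S.R.genideal_minimal S.R.genideal_ideal GA) auto
      have "G \<subseteq> P"
        using S.R.genideal_self[OF G(1)] G(3) I(2) by blast
      then have "?J \<subseteq> P"
        using Aq by (intro S.R.genideal_minimal P.ideal_axioms) (auto simp: spec_map_def)
      moreover have "fin_gen_ideal ?J S"
        unfolding fin_gen_ideal_def using GA G A by blast
      ultimately obtain F where F: "Poly_Mapping.keys F \<subseteq> carrier L \<times> carrier M"
        "?J \<subseteq> {s \<in> carrier S. scale s F \<in> null}" "{s \<in> carrier S. scale s F \<in> null} \<subseteq> P"
        using PA unfolding sK_tensor_module_iff by blast
      have "\<forall>a\<in>A. scale (\<phi> a) F \<in> null"
        using F(2) GAJ by blast
      then have "F \<in> tspan {x \<in> carrier L. \<forall>a\<in>A. a \<odot>\<^bsub>L\<^esub> x = \<zero>\<^bsub>L\<^esub>}"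
        using annihilated_tspan[OF A(2,1)] F(1) by simp
      then obtain X m where X: "finite X" "X \<subseteq> {x \<in> carrier L. \<forall>a\<in>A. a \<odot>\<^bsub>L\<^esub> x = \<zero>\<^bsub>L\<^esub>}"
        "m \<in> X \<rightarrow> carrier M" "F \<doteq> (\<Sum>x\<in>X. frag_of (x, m x))"
        unfolding tspan_def by auto
      have "r \<odot>\<^bsub>L\<^esub> x = \<zero>\<^bsub>L\<^esub>" if "x \<in> X" "r \<in> ?q" for x r
      proof -
        have x: "x \<in> carrier L" using that X by blast
        have "ideal (ann R L x) R"
          by (rule L.ideal_ann[OF x])
        moreover have "A \<subseteq> ann R L x"
          using that X(2) A(1) by (auto simp: ann_def)
        ultimately have "?q \<subseteq> ann R L x"
          unfolding A(3) by (rule L.R.genideal_minimal)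
        then show ?thesis
          using that by (auto simp: ann_def)
      qed
      then have Xq: "X \<subseteq> {x \<in> carrier L. \<forall>r\<in>?q. r \<odot>\<^bsub>L\<^esub> x = \<zero>\<^bsub>L\<^esub>}"
        using X(2) by blast
      have scale_iff: "scale s F \<in> null \<longleftrightarrow> (\<Sum>x\<in>X. frag_of (x, s \<odot>\<^bsub>M\<^esub> m x)) \<in> null"
        if "s \<in> carrier S" for s
        using teq_null_iff[OF scale_teq[OF that X(4)]] unfolding scale_sum[OF X(1)] .
      have J: "?J \<subseteq> carrier S"
        using F(2) by blast
      obtain y w where "y \<in> carrier L" "w \<in> carrier M" "ann R L y = ?q"
        "\<forall>s\<in>?J. frag_of (y, s \<odot>\<^bsub>M\<^esub> w) \<in> null" "\<forall>s\<in>carrier S. frag_of (y, s \<odot>\<^bsub>M\<^esub> w) \<in> null \<longrightarrow> s \<in> P"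
        using pure_tensor_between[OF P J X(1) Xq X(3)] F(2,3) scale_iff by blast
      then show ?thesis
        using IJ J by (intro bexI[of _ y] bexI[of _ w]) auto
    qed
    \<comment> \<open>The ideal generated by the empty set yields one \<open>y\<close> with
      annihilator \<open>?q\<close>, fixed before \<open>I\<close> is chosen; this makes
      \<open>?q\<close> an associated prime.\<close>
    have "Idl\<^bsub>S\<^esub> {} \<subseteq> P"
      by (intro S.R.genideal_minimal P.ideal_axioms) simp
    then obtain y where y: "y \<in> carrier L" "ann R L y = ?q"
      using approx[of "Idl\<^bsub>S\<^esub> {}"] unfolding fin_gen_ideal_def by blast
    have "\<exists>w\<in>carrier M. I \<subseteq> {s \<in> carrier S. frag_of (y, s \<odot>\<^bsub>M\<^esub> w) \<in> null} \<and>
        {s \<in> carrier S. frag_of (y, s \<odot>\<^bsub>M\<^esub> w) \<in> null} \<subseteq> P"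
      if I: "fin_gen_ideal I S" "I \<subseteq> P" for I
    proof -
      obtain y' w where y': "y' \<in> carrier L" "ann R L y' = ?q" and "w \<in> carrier M"
        "I \<subseteq> {s \<in> carrier S. frag_of (y', s \<odot>\<^bsub>M\<^esub> w) \<in> null}"
        "{s \<in> carrier S. frag_of (y', s \<odot>\<^bsub>M\<^esub> w) \<in> null} \<subseteq> P"
        using approx[OF I] by blast
      \<comment> \<open>The element \<open>y'\<close> depends on \<open>I\<close>, but vanishing of
        y' \<otimes> w depends only on the annihilator of \<open>y'\<close>, so the fixed
        \<open>y\<close> can replace it.\<close>
      moreover have "frag_of (y', s \<odot>\<^bsub>M\<^esub> w) \<in> null \<longleftrightarrow> frag_of (y, s \<odot>\<^bsub>M\<^esub> w) \<in> null" if "s \<in> carrier S" for s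
        using null_frag_of_iff y y' \<open>w \<in> carrier M\<close> that by simp
      ultimately show ?thesis
        by (intro bexI[of _ w]) auto
    qed
    then have "P \<in> sK S (quot_module M (ideal_times ?q (restrict_scalars \<phi> M)))"
      using P sK_quot_module_iff[OF y(1)] y(2) by (auto simp: Spec_def)
    moreover have "?q \<in> Ass R L"
      using q y by (auto simp: Ass_def Spec_def)
    ultimately show "P \<in> ?B" by blast
  qed
qed

end

theorem theorem4p7:
  fixes R :: "('r, 'x) ring_scheme" and S :: "('s, 'y) ring_scheme"
    and \<phi> :: "'r \<Rightarrow> 's"
    and L :: "('r, 'l, 'u) module_scheme" and M :: "('s, 'm, 'v) module_scheme"
  assumes "cring R" and "noetherian_ring R" and "cring S"
    and "\<phi> \<in> ring_hom R S"
    and "module R L" and "module S M"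
    and "flat_module TYPE((nat \<Rightarrow> 'r + 'l) set) R (restrict_scalars \<phi> M)"
  shows "let LM = tensor_module R \<phi> L M;
             U = (\<Union>\<pp> \<in> Ass R L. sK S (quot_module M (ideal_times \<pp> (restrict_scalars \<phi> M))))
         in
           (\<forall>P \<in> sK S LM. \<exists>P' \<in> Spec S. spec_map R \<phi> P' = spec_map R \<phi> P \<and> P' \<subseteq> P \<and> P' \<in> U) \<and>
           minimal_elements (sK S LM) = minimal_elements U \<and>
           (INC R S \<phi> \<longrightarrow> sK S LM = U)"
proof -
  interpret tensor R L "restrict_scalars \<phi> M"
    using assms(5,7) unfolding flat_module_def by (blast intro: tensor.intro)
  \<comment> \<open>Singletons of constant functions embed the element type of \<open>L\<close> into
    the type of the test modules.\<close>
  let ?\<iota> = "\<lambda>x. {\<lambda>_. Inr x} :: (nat \<Rightarrow> 'r + 'l) set"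
  have "inj ?\<iota>"
    by (auto simp: inj_def fun_eq_iff)
  note crit = flat_criterion[OF assms(7) this]
  interpret flat_base_change R L \<phi> S M
  proof (intro flat_base_change.intro flat_tensor.intro flat_tensor_axioms.intro
      flat_base_change_axioms.intro)
    fix I :: "'l set" and x m
    assume *: "finite I" "x \<in> I \<rightarrow> carrier L" "m \<in> I \<rightarrow> carrier (restrict_scalars \<phi> M)"
      "(\<Sum>i\<in>I. frag_of (x i, m i)) \<in> tensor_null R L (restrict_scalars \<phi> M)"
    show "\<exists>u\<in>syzygy_span R L (restrict_scalars \<phi> M) x I. \<forall>i\<in>I. u i = m i"
      by (rule crit[OF *]) blast
  qed (fact assms tensor_axioms)+
  show ?thesis
    unfolding Let_def sK_tensor_module[OF assms(2)]
  \<comment> \<open>After rewriting by the equality of the two sets, the second and third claims are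
    reflexivity, and the first holds with P' = P.\<close>
  proof (intro conjI ballI impI refl)
    let ?U = "\<Union>\<pp> \<in> Ass R L. sK S (quot_module M (ideal_times \<pp> (restrict_scalars \<phi> M)))"
    fix P assume P: "P \<in> ?U"
    then have "P \<in> Spec S"
      by (auto simp: sK_def)
    then show "\<exists>P' \<in> Spec S. spec_map R \<phi> P' = spec_map R \<phi> P \<and> P' \<subseteq> P \<and> P' \<in> ?U"
      using P by blast
  qed
qed

end
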